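(* There exist absolute constants $c>0$ and $\varepsilon_0\in(0,1)$ such that the following holds. Let $0<\varepsilon<\varepsilon_0$, let $d\ge2$ be an integer, let $\mathcal{X},\mathcal{C}\subseteq\mathbb{R}^d$ be finite sets (with the Euclidean distance $\delta$), let $1\le k\le|\mathcal{C}|$, and let $\rho=32\cdot(2d)^{8d}\cdot\varepsilon^{-36d/\varepsilon}$. Let $\mathcal{S}\subseteq\mathcal{C}$ with $|\mathcal{S}|=k$ be locally optimal with respect to $\rho$-swaps, i.e. there are no $P\subseteq\mathcal{C}\setminus\mathcal{S}$, $Q\subseteq\mathcal{S}$ with $|P|=|Q|\le\rho$ and $\mathrm{cost}((\mathcal{S}\setminus Q)\cup P)<\mathrm{cost}(\mathcal{S})$, and let $\mathcal{O}\subseteq\mathcal{C}$ with $|\mathcal{O}|=k$ minimize $\mathrm{cost}$. Then $\mathrm{cost}(\mathcal{S})\le(1+c\,\varepsilon)\cdot\mathrm{cost}(\mathcal{O})$.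
   Context: For $S\subseteq\mathcal{C}$ and $j\in\mathcal{X}$, $\delta(j,S)=\min_{i\in S}\|j-i\|_2$, and $\mathrm{cost}(S)=\sum_{j\in\mathcal{X}}\delta(j,S)^2$ (the discrete $k$-means cost). *)

theory Defs
  imports "HOL-Analysis.Analysis"
begin

text \<open>
  The constants of the theorem must not depend on the dimension, so the dimension is a
  natural number and not a type: \<open>\<real>\<^sup>d\<close> is \<open>topspace (Euclidean_space d)\<close>, the functions
  \<open>nat \<Rightarrow> real\<close> that vanish at all indices \<open>i \<ge> d\<close>.
\<close>

definition eucl_dist :: "nat \<Rightarrow> (nat \<Rightarrow> real) \<Rightarrow> (nat \<Rightarrow> real) \<Rightarrow> real" where
  "eucl_dist d x y = L2_set (\<lambda>i. x i - y i) {..<d}"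

text \<open>Only meaningful for finite nonempty \<open>S\<close>, since \<open>Min\<close> is unspecified otherwise.\<close>

definition dist_to_centers :: "nat \<Rightarrow> (nat \<Rightarrow> real) \<Rightarrow> (nat \<Rightarrow> real) set \<Rightarrow> real" where
  "dist_to_centers d j S = Min ((\<lambda>i. eucl_dist d j i) ` S)"

definition kmeans_cost :: "nat \<Rightarrow> (nat \<Rightarrow> real) set \<Rightarrow> (nat \<Rightarrow> real) set \<Rightarrow> real" where
  "kmeans_cost d X S = (\<Sum>j\<in>X. (dist_to_centers d j S)\<^sup>2)"

definition swap_locally_optimal ::
  "nat \<Rightarrow> (nat \<Rightarrow> real) set \<Rightarrow> (nat \<Rightarrow> real) set \<Rightarrow> real \<Rightarrow> (nat \<Rightarrow> real) set \<Rightarrow> bool" where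
  "swap_locally_optimal d X C \<rho> S \<longleftrightarrow>
     \<not> (\<exists>P Q. P \<subseteq> C - S \<and> Q \<subseteq> S \<and> card P = card Q \<and> real (card Q) \<le> \<rho> \<and>
              kmeans_cost d X ((S - Q) \<union> P) < kmeans_cost d X S)"

definition swap_size :: "nat \<Rightarrow> real \<Rightarrow> real" where
  "swap_size d \<epsilon> = 32 * (2 * real d) ^ (8 * d) * \<epsilon> powr (- (36 * real d / \<epsilon>))"

end

theory Submission
  imports Defs
begin

text \<open>
  Let \<open>A = S - Opt\<close> and \<open>B = Opt - S\<close>. Labels on \<open>A \<union> B\<close> whose classes are small and contain as many
  points of \<open>A\<close> as of \<open>B\<close> give one swap per label, none of which lowers the cost. If \<open>s \<in> A\<close> and
  \<open>t \<in> B\<close> have the same label, then after each of these swaps \<open>s\<close> or \<open>t\<close> is open. If such a pair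
  lies within \<open>\<tau> * \<delta> a b\<close> of \<open>{a, b}\<close>, where \<open>a \<in> A\<close> and \<open>b \<in> B\<close> are the nearest centers of a
  client, then the total change of this client over all swaps is at most
  \<open>e\<^sup>2 - c\<^sup>2 + O(\<tau> + \<tau>\<^sup>2) * (c\<^sup>2 + e\<^sup>2)\<close>, where \<open>c\<close> and \<open>e\<close> are its distances to \<open>S\<close> and \<open>Opt\<close>.

  It remains to find random labels for which \<open>\<tau> = 3\<close> always works and \<open>\<tau> = \<epsilon>\<close> works with
  probability \<open>1 - O(\<epsilon>)\<close>. Let \<open>opp_dist v\<close> be the distance of \<open>v\<close> to the opposite set. A net with
  covering radius \<open>2 * opp_dist v\<close> provides disjoint pairs (a net point and its nearest opposite
  center) which are never separated; they serve all \<open>a\<close>, \<open>b\<close> for which \<open>opp_dist a\<close> or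
  \<open>opp_dist b\<close> is much smaller than \<open>\<delta> a b\<close>. All other \<open>a\<close>, \<open>b\<close> are represented by points of a
  net with covering radius \<open>\<epsilon> * opp_dist v\<close>. The points of both nets are grouped into blocks
  according to a randomly shifted band of \<open>log (opp_dist v)\<close> and a randomly shifted grid at the
  scale of the band; a packing argument bounds the size of the blocks. Finally, blocks are merged
  into balanced classes: integers of modulus at most \<open>\<beta>\<close> with sum zero split into zero-sum groups
  of at most \<open>2 * \<beta> + 1\<close> members.
\<close>

subsection \<open>Greedy nets\<close>

lemma exists_greedy_net:
  fixes w :: "'a \<Rightarrow> 'b::linorder"
  assumes "finite V" "\<And>v. R v v"
  shows "\<exists>E\<subseteq>V. (\<forall>v\<in>V. \<exists>u\<in>E. w u \<le> w v \<and> R v u) \<and>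
    (\<forall>u\<in>E. \<forall>v\<in>E. u \<noteq> v \<longrightarrow> (w u \<le> w v \<and> \<not> R v u) \<or> (w v \<le> w u \<and> \<not> R u v))"
  using assms(1)
proof (induction V rule: finite_ranking_induct[where f = w])
  case empty
  show ?case by simp
next
  case (insert x V)
  obtain E where E_subset: "E \<subseteq> V"
    and covers: "\<forall>v\<in>V. \<exists>u\<in>E. w u \<le> w v \<and> R v u"
    and separated: "\<forall>u\<in>E. \<forall>v\<in>E. u \<noteq> v \<longrightarrow> (w u \<le> w v \<and> \<not> R v u) \<or> (w v \<le> w u \<and> \<not> R u v)"
    using insert.IH by (elim exE conjE) (rule that)
  have x_max: "w u \<le> w x" if "u \<in> E" for u using that E_subset insert.hyps(2) by blast
  show ?case
  proof (cases "\<exists>u\<in>E. R x u")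
    case True
    then have "\<forall>v\<in>insert x V. \<exists>u\<in>E. w u \<le> w v \<and> R v u" using covers x_max by blast
    then show ?thesis using E_subset separated by (intro exI[of _ E]) blast
  next
    case False
    have "\<forall>v\<in>insert x V. \<exists>u\<in>insert x E. w u \<le> w v \<and> R v u"
      using covers assms(2) by auto
    then show ?thesis
      using E_subset separated x_max False by (intro exI[of _ "insert x E"] conjI ballI impI) auto
  qed
qed

subsection \<open>Random shifts\<close>

lemma sum_div_consecutive:
  fixes a :: int
  assumes "M > 0"
  shows "(\<Sum>q<M. (a + int q) div int M) = a"
proof -
  have step: "(\<Sum>q<M. (b + 1 + int q) div int M) = (\<Sum>q<M. (b + int q) div int M) + 1" for b
  proof -
    let ?g = "\<lambda>q. (b + int q) div int M"
    have "(\<Sum>q<M. (b + 1 + int q) div int M) - (\<Sum>q<M. ?g q) = (\<Sum>q<M. ?g (Suc q) - ?g q)"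
      by (simp add: sum_subtractf algebra_simps)
    also have "\<dots> = ?g M - ?g 0" by (rule sum_lessThan_telescope)
    also have "\<dots> = 1" using assms by simp
    finally show ?thesis by simp
  qed
  show ?thesis
  proof (induction a rule: int_induct[where k = 0])
    case base
    show ?case by (intro sum.neutral) auto
  next
    case (step1 i)
    then show ?case using step[of i] by simp
  next
    case (step2 i)
    then show ?case using step[of "i - 1"] by simp
  qed
qed

lemma hermite_identity:
  fixes x :: real
  assumes "M > 0"
  shows "(\<Sum>q<M. \<lfloor>x + real q / real M\<rfloor>) = \<lfloor>real M * x\<rfloor>"
proof -
  have "\<lfloor>x + real q / real M\<rfloor> = (\<lfloor>real M * x\<rfloor> + int q) div int M" for q
  proof -
    have "x + real q / real M = (real M * x + real q) / real_of_int (int M)"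
      using assms by (simp add: field_simps)
    then have "\<lfloor>x + real q / real M\<rfloor> = \<lfloor>real M * x + real q\<rfloor> div int M"
      by (metis floor_divide_real_eq_div of_nat_0_le_iff)
    then show ?thesis by simp
  qed
  then show ?thesis using sum_div_consecutive[OF assms] by simp
qed

lemma card_floor_shift_neq:
  fixes x y :: real
  assumes "M > 0"
  shows "real (card {q\<in>{..<M}. \<lfloor>x + real q / real M\<rfloor> \<noteq> \<lfloor>y + real q / real M\<rfloor>})
    \<le> real M * \<bar>x - y\<bar> + 1"
proof (induction x y rule: linorder_wlog)
  case (le x y)
  let ?fl = "\<lambda>z q. \<lfloor>z + real q / real M\<rfloor>"
  have mono: "?fl x q \<le> ?fl y q" for q using le by (intro floor_mono) auto
  have "int (card {q\<in>{..<M}. ?fl x q \<noteq> ?fl y q}) = (\<Sum>q | q < M \<and> ?fl x q \<noteq> ?fl y q. 1)" by simp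
  also have "\<dots> \<le> (\<Sum>q | q < M \<and> ?fl x q \<noteq> ?fl y q. ?fl y q - ?fl x q)"
  proof (rule sum_mono)
    fix q assume "q \<in> {q. q < M \<and> ?fl x q \<noteq> ?fl y q}"
    then show "1 \<le> ?fl y q - ?fl x q" using mono[of q] by auto
  qed
  also have "\<dots> \<le> (\<Sum>q<M. ?fl y q - ?fl x q)"
    using mono by (intro sum_mono2) auto
  also have "\<dots> = \<lfloor>real M * y\<rfloor> - \<lfloor>real M * x\<rfloor>"
    by (simp add: sum_subtractf hermite_identity[OF assms])
  finally have "real (card {q\<in>{..<M}. ?fl x q \<noteq> ?fl y q}) \<le> real M * y - real M * x + 1"
    by linarith
  then show ?case using le by (simp add: algebra_simps)
next
  case (sym x y)
  then show ?case by (simp add: abs_minus_commute eq_commute)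
qed

lemma card_Collect_Times_le:
  assumes "finite I" "finite J" "0 \<le> t"
    and fibre: "\<And>i. i \<in> I \<Longrightarrow> \<not> P i \<Longrightarrow> real (card {j\<in>J. Q i j}) \<le> t"
  shows "real (card {(i, j) \<in> I \<times> J. Q i j})
    \<le> real (card {i\<in>I. P i}) * real (card J) + real (card I) * t"
proof -
  have "{(i, j) \<in> I \<times> J. Q i j} = (SIGMA i:I. {j\<in>J. Q i j})" by auto
  then have "real (card {(i, j) \<in> I \<times> J. Q i j}) = (\<Sum>i\<in>I. real (card {j\<in>J. Q i j}))"
    using assms by (simp add: card_SigmaI)
  also have "\<dots> \<le> (\<Sum>i\<in>I. (if P i then real (card J) else 0) + t)"
  proof (rule sum_mono)
    fix i assume "i \<in> I"
    have "card {j\<in>J. Q i j} \<le> card J" using assms(2) by (intro card_mono) auto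
    then show "real (card {j\<in>J. Q i j}) \<le> (if P i then real (card J) else 0) + t"
      using fibre[OF \<open>i \<in> I\<close>] \<open>0 \<le> t\<close> by auto
  qed
  also have "\<dots> = real (card {i\<in>I. P i}) * real (card J) + real (card I) * t"
    using assms(1) by (simp add: sum.distrib sum.If_cases Int_def conj_commute)
  finally show ?thesis .
qed

subsection \<open>Zero-sum groups and balanced labelings\<close>

lemma exists_bounded_extension:
  fixes z :: "'a \<Rightarrow> 'b::linordered_idom"
  assumes "finite I" "sum z I = 0" and bound: "\<And>i. i \<in> I \<Longrightarrow> \<bar>z i\<bar> \<le> b"
    and "G \<subset> I" and G_bound: "\<bar>sum z G\<bar> \<le> b"
  shows "\<exists>i\<in>I - G. \<bar>z i + sum z G\<bar> \<le> b"
proof -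
  have "finite (I - G)" "I - G \<noteq> {}" using assms(1,4) by auto
  note sum_pos = sum_pos[OF this]
  have rest: "sum z (I - G) = - sum z G"
    using sum_diff[of I G z] assms(1,2,4) by (simp add: psubset_eq)
  have "\<exists>i\<in>I - G. (0 < sum z G \<and> z i \<le> 0) \<or> (sum z G \<le> 0 \<and> 0 \<le> z i)"
  proof (rule ccontr)
    assume contr: "\<not> ?thesis"
    show False
    proof (cases "0 < sum z G")
      case True
      then have "0 < sum z (I - G)" using contr by (intro sum_pos) force
      with rest True show False by simp
    next
      case False
      then have "0 < sum (\<lambda>i. - z i) (I - G)" using contr by (intro sum_pos) force
      with rest False show False by (simp add: sum_negf)
    qed
  qed
  then obtain i where i: "i \<in> I - G" "(0 < sum z G \<and> z i \<le> 0) \<or> (sum z G \<le> 0 \<and> 0 \<le> z i)"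
    by blast
  have "\<bar>z i\<bar> \<le> b" using bound i(1) by blast
  with i(2) G_bound have "\<bar>z i + sum z G\<bar> \<le> b" by linarith
  with i(1) show ?thesis by blast
qed

lemma exists_list_bounded_prefix_sums:
  fixes z :: "'a \<Rightarrow> 'b::linordered_idom"
  assumes "finite I" "sum z I = 0" "\<And>i. i \<in> I \<Longrightarrow> \<bar>z i\<bar> \<le> b" "0 \<le> b" "n \<le> card I"
  shows "\<exists>xs. distinct xs \<and> set xs \<subseteq> I \<and> length xs = n \<and>
    (\<forall>k\<le>n. \<bar>sum z (set (take k xs))\<bar> \<le> b)"
  using assms(5)
proof (induction n)
  case 0
  then show ?case using assms(4) by simp
next
  case (Suc n)
  then obtain xs where xs: "distinct xs" "set xs \<subseteq> I" "length xs = n"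
    and prefixes: "\<forall>k\<le>n. \<bar>sum z (set (take k xs))\<bar> \<le> b" by auto
  have "set xs \<subset> I" using xs Suc.prems distinct_card[OF xs(1)] by auto
  moreover have "\<bar>sum z (set xs)\<bar> \<le> b" using prefixes xs(3) by force
  ultimately obtain i where i: "i \<in> I - set xs" "\<bar>z i + sum z (set xs)\<bar> \<le> b"
    using exists_bounded_extension[OF assms(1,2,3)] by blast
  then have "\<forall>k\<le>Suc n. \<bar>sum z (set (take k (xs @ [i])))\<bar> \<le> b"
    using prefixes xs(3) by (auto simp: le_Suc_eq)
  then show ?case using xs i(1) by (intro exI[of _ "xs @ [i]"]) auto
qed

text \<open>
  By pigeonhole, two of the first \<open>2 * b + 2\<close> prefixes in an ordering with bounded prefix sums have
  the same sum.
\<close>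

lemma exists_small_zero_sum_subset:
  fixes z :: "'a \<Rightarrow> int"
  assumes "finite I" "I \<noteq> {}" "sum z I = 0" and bound: "\<And>i. i \<in> I \<Longrightarrow> \<bar>z i\<bar> \<le> int b"
  shows "\<exists>J\<subseteq>I. J \<noteq> {} \<and> card J \<le> 2 * b + 1 \<and> sum z J = 0"
proof (cases "card I \<le> 2 * b + 1")
  case True
  then show ?thesis using assms by blast
next
  case False
  define N where "N = 2 * b + 1"
  obtain xs where xs: "distinct xs" "set xs \<subseteq> I" "length xs = N"
    and prefixes: "\<forall>k\<le>N. \<bar>sum z (set (take k xs))\<bar> \<le> int b"
    using exists_list_bounded_prefix_sums[OF assms(1,3) bound, of N] False by (auto simp: N_def)
  define S where "S k = sum z (set (take k xs))" for k
  have "S ` {..N} \<subseteq> {- int b..int b}" using prefixes by (auto simp: S_def abs_le_iff minus_le_iff)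
  then have "card (S ` {..N}) \<le> card {- int b..int b}" by (intro card_mono) auto
  then have "\<not> inj_on S {..N}" by (intro pigeonhole) (simp add: N_def)
  then obtain k l where "k < l" "l \<le> N" "S k = S l"
    unfolding inj_on_def by (metis atMost_iff linorder_neqE_nat)
  define J where "J = set (drop k (take l xs))"
  have split: "take l xs = take k xs @ drop k (take l xs)"
    using \<open>k < l\<close> append_take_drop_id[of k "take l xs"] by (simp add: min_def)
  have "distinct (take l xs)" using xs(1) by simp
  with split have "set (take k xs) \<inter> J = {}" unfolding J_def by (metis distinct_append)
  moreover have "set (take l xs) = set (take k xs) \<union> J" unfolding J_def by (metis split set_append)
  ultimately have "S l = S k + sum z J" unfolding S_def J_def by (simp add: sum.union_disjoint)
  moreover have "card J = l - k"
    using xs(1,3) \<open>l \<le> N\<close> by (simp add: J_def distinct_card)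
  moreover have "J \<subseteq> I" using xs(2) unfolding J_def by (meson in_set_dropD in_set_takeD subset_iff)
  ultimately show ?thesis
    using \<open>k < l\<close> \<open>l \<le> N\<close> \<open>S k = S l\<close> by (intro exI[of _ J]) (auto simp: N_def)
qed

lemma exists_zero_sum_grouping:
  fixes z :: "'a \<Rightarrow> int"
  assumes "finite I" "sum z I = 0" "\<And>i. i \<in> I \<Longrightarrow> \<bar>z i\<bar> \<le> int b"
  shows "\<exists>g :: 'a \<Rightarrow> nat. \<forall>n. card {i\<in>I. g i = n} \<le> 2 * b + 1 \<and> sum z {i\<in>I. g i = n} = 0"
  using assms
proof (induction I rule: finite_psubset_induct)
  case (psubset I)
  show ?case
  proof (cases "I = {}")
    case True
    then show ?thesis by simp
  next
    case False
    from exists_small_zero_sum_subset[OF psubset.hyps(1) False psubset.prems]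
    obtain J where J: "J \<subseteq> I" "J \<noteq> {}" "card J \<le> 2 * b + 1" "sum z J = 0" by blast
    have "sum z (I - J) = 0"
      using J sum_diff[OF psubset.hyps(1) J(1), of z] psubset.prems(1) by simp
    moreover have "I - J \<subset> I" using J by blast
    ultimately obtain g :: "'a \<Rightarrow> nat" where
      g: "\<And>n. card {i\<in>I - J. g i = n} \<le> 2 * b + 1 \<and> sum z {i\<in>I - J. g i = n} = 0"
      using psubset.IH[of "I - J"] psubset.prems(2) by blast
    define g' where "g' i = (if i \<in> J then 0 else Suc (g i))" for i
    have "{i\<in>I. g' i = 0} = J" using J by (auto simp: g'_def)
    moreover have "{i\<in>I. g' i = Suc n} = {i\<in>I - J. g i = n}" for n by (auto simp: g'_def)
    ultimately have "card {i\<in>I. g' i = n} \<le> 2 * b + 1 \<and> sum z {i\<in>I. g' i = n} = 0" for n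
      using J g by (cases n) auto
    then show ?thesis by blast
  qed
qed

lemma card_Collect_mem_eq_sum_fibres:
  assumes "finite A" "finite J"
  shows "card {a\<in>A. f a \<in> J} = (\<Sum>x\<in>J. card {a\<in>A. f a = x})"
proof -
  have "{a\<in>A. f a \<in> J} = (\<Union>x\<in>J. {a\<in>A. f a = x})" by auto
  then show ?thesis using assms by (simp only:) (subst card_UN_disjoint, auto)
qed

definition balanced_labeling :: "'a set \<Rightarrow> 'a set \<Rightarrow> real \<Rightarrow> ('a \<Rightarrow> 'l) \<Rightarrow> bool" where
  "balanced_labeling A B \<rho> f \<longleftrightarrow>
    (\<forall>l. card {a\<in>A. f a = l} = card {b\<in>B. f b = l} \<and> real (card {b\<in>B. f b = l}) \<le> \<rho>)"

lemma balanced_labelingD: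
  assumes "balanced_labeling A B \<rho> f"
  shows "card {a\<in>A. f a = l} = card {b\<in>B. f b = l}" "real (card {b\<in>B. f b = l}) \<le> \<rho>"
  using assms by (auto simp: balanced_labeling_def)

lemma balanced_labeling_mono: "balanced_labeling A B \<rho> f \<Longrightarrow> \<rho> \<le> \<rho>' \<Longrightarrow> balanced_labeling A B \<rho>' f"
  by (meson balanced_labeling_def order_trans)

lemma exists_balanced_coarsening:
  fixes f :: "'a \<Rightarrow> 'b"
  assumes fin: "finite A" "finite B" and "card A = card B"
    and small: "\<And>x. card {v\<in>A \<union> B. f v = x} \<le> \<beta>"
  shows "\<exists>g :: 'b \<Rightarrow> nat. balanced_labeling A B (real ((2 * \<beta> + 1) * \<beta>)) (g \<circ> f)"
proof -
  define I where "I = f ` (A \<union> B)"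
  define z where "z x = int (card {a\<in>A. f a = x}) - int (card {b\<in>B. f b = x})" for x
  have "finite I" using fin by (simp add: I_def)
  have small_fibres: "card {a\<in>A. f a = x} \<le> \<beta>" "card {b\<in>B. f b = x} \<le> \<beta>" for x
    using small[of x] card_mono[of "{v\<in>A \<union> B. f v = x}" "{a\<in>A. f a = x}"]
      card_mono[of "{v\<in>A \<union> B. f v = x}" "{b\<in>B. f b = x}"] fin by fastforce+
  have sum_z: "sum z J = int (card {a\<in>A. f a \<in> J}) - int (card {b\<in>B. f b \<in> J})"
    if "finite J" for J
    using card_Collect_mem_eq_sum_fibres[OF fin(1) that, of f]
      card_Collect_mem_eq_sum_fibres[OF fin(2) that, of f]
    by (simp add: z_def sum_subtractf)
  have "\<bar>z x\<bar> \<le> int \<beta>" for x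
    using small_fibres[of x] by (simp add: z_def)
  moreover have "{a\<in>A. f a \<in> I} = A" "{b\<in>B. f b \<in> I} = B" by (auto simp: I_def)
  then have "sum z I = 0" using sum_z[OF \<open>finite I\<close>] assms(3) by simp
  ultimately obtain g :: "'b \<Rightarrow> nat" where
    g: "\<And>n. card {i\<in>I. g i = n} \<le> 2 * \<beta> + 1 \<and> sum z {i\<in>I. g i = n} = 0"
    using exists_zero_sum_grouping[OF \<open>finite I\<close>, of z \<beta>] by blast
  have "card {a\<in>A. g (f a) = n} = card {b\<in>B. g (f b) = n} \<and>
    card {b\<in>B. g (f b) = n} \<le> (2 * \<beta> + 1) * \<beta>" for n
  proof -
    define J where "J = {i\<in>I. g i = n}"
    have "finite J" using \<open>finite I\<close> by (simp add: J_def)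
    have classes: "{a\<in>A. g (f a) = n} = {a\<in>A. f a \<in> J}" "{b\<in>B. g (f b) = n} = {b\<in>B. f b \<in> J}"
      by (auto simp: J_def I_def)
    have "card {b\<in>B. f b \<in> J} \<le> (\<Sum>x\<in>J. \<beta>)"
      unfolding card_Collect_mem_eq_sum_fibres[OF fin(2) \<open>finite J\<close>]
      using small_fibres by (intro sum_mono) auto
    also have "\<dots> = card J * \<beta>" by simp
    also have "\<dots> \<le> (2 * \<beta> + 1) * \<beta>" using g[of n] unfolding J_def by (intro mult_right_mono) auto
    finally show ?thesis
      using sum_z[OF \<open>finite J\<close>] g[of n] classes by (simp add: J_def)
  qed
  then have "balanced_labeling A B (real ((2 * \<beta> + 1) * \<beta>)) (g \<circ> f)"
    unfolding balanced_labeling_def comp_apply by (metis of_nat_mono)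
  then show ?thesis by blast
qed

subsection \<open>Euclidean distance, grids and bands\<close>

lemma eucl_dist_nonneg [simp]: "0 \<le> eucl_dist d x y"
  by (simp add: eucl_dist_def)

lemma eucl_dist_commute: "eucl_dist d x y = eucl_dist d y x"
  by (simp add: eucl_dist_def L2_set_def power2_commute)

lemma eucl_dist_triangle: "eucl_dist d x z \<le> eucl_dist d x y + eucl_dist d y z"
  using L2_set_triangle_ineq[of "\<lambda>i. x i - y i" "\<lambda>i. y i - z i" "{..<d}"]
  by (simp add: eucl_dist_def)

lemma abs_coordinate_diff_le_eucl_dist:
  assumes "i < d"
  shows "\<bar>x i - y i\<bar> \<le> eucl_dist d x y"
  using member_le_L2_set[of "{..<d}" i "\<lambda>i. \<bar>x i - y i\<bar>"] assms
  by (simp add: eucl_dist_def L2_set_def)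

lemma eucl_dist_le_mult_dim:
  assumes "\<And>i. i < d \<Longrightarrow> \<bar>x i - y i\<bar> \<le> s"
  shows "eucl_dist d x y \<le> real d * s"
proof -
  have "eucl_dist d x y \<le> (\<Sum>i<d. \<bar>x i - y i\<bar>)"
    unfolding eucl_dist_def by (rule L2_set_le_sum_abs)
  also have "\<dots> \<le> (\<Sum>i<d. s)"
    using assms by (intro sum_mono) auto
  finally show ?thesis by simp
qed

lemma Metric_space_eucl_dist: "Metric_space (topspace (Euclidean_space d)) (eucl_dist d)"
proof
  fix x y assume space: "x \<in> topspace (Euclidean_space d)" "y \<in> topspace (Euclidean_space d)"
  show "eucl_dist d x y = 0 \<longleftrightarrow> x = y"
  proof
    assume "eucl_dist d x y = 0"
    then have "x i = y i" if "i < d" for i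
      using abs_coordinate_diff_le_eucl_dist[OF that, of x y] by simp
    moreover have "x i = y i" if "\<not> i < d" for i
      using space that by (simp add: topspace_Euclidean_space)
    ultimately show "x = y" by blast
  qed (simp add: eucl_dist_def L2_set_def)
qed (simp_all add: eucl_dist_commute eucl_dist_triangle)

text \<open>
  The same shift is used for all coordinates: the union bound over coordinates needs no
  independence.
\<close>

definition grid_cell :: "nat \<Rightarrow> real \<Rightarrow> real \<Rightarrow> (nat \<Rightarrow> real) \<Rightarrow> nat \<Rightarrow> int" where
  "grid_cell d W s v = (\<lambda>i\<in>{..<d}. \<lfloor>v i / W + s\<rfloor>)"

lemma grid_cell_eq_iff:
  "grid_cell d W s x = grid_cell d W s y \<longleftrightarrow> (\<forall>i<d. \<lfloor>x i / W + s\<rfloor> = \<lfloor>y i / W + s\<rfloor>)"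
  by (auto simp: grid_cell_def restrict_def fun_eq_iff)

lemma eucl_dist_le_if_grid_cell_eq:
  assumes "0 < W" "grid_cell d W s x = grid_cell d W s y"
  shows "eucl_dist d x y \<le> real d * W"
proof (rule eucl_dist_le_mult_dim)
  fix i assume "i < d"
  then have "\<lfloor>x i / W + s\<rfloor> = \<lfloor>y i / W + s\<rfloor>" using assms(2) by (simp add: grid_cell_eq_iff)
  then have "\<bar>x i / W - y i / W\<bar> \<le> 1" by linarith
  then have "\<bar>x i - y i\<bar> / W \<le> 1"
    using assms(1) by (simp add: diff_divide_distrib[symmetric] abs_divide)
  then show "\<bar>x i - y i\<bar> \<le> W" using assms(1) by simp
qed

lemma card_separated_in_box:
  assumes "finite F" "0 < r" "0 \<le> W" "0 < d"
    and separated: "\<And>x y. x \<in> F \<Longrightarrow> y \<in> F \<Longrightarrow> x \<noteq> y \<Longrightarrow> r < eucl_dist d x y"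
    and box: "\<And>x i. x \<in> F \<Longrightarrow> i < d \<Longrightarrow> p i \<le> x i \<and> x i \<le> p i + W"
  shows "real (card F) \<le> (W * real d / r + 2) ^ d"
proof -
  define w where "w = r / real d"
  have w: "0 < w" "real d * w = r" using assms by (simp_all add: w_def)
  define I where "I i = {\<lfloor>p i / w\<rfloor>..\<lfloor>(p i + W) / w\<rfloor>}" for i
  have inj: "inj_on (grid_cell d w 0) F"
  proof (rule inj_onI, rule ccontr)
    fix x y assume "x \<in> F" "y \<in> F" "grid_cell d w 0 x = grid_cell d w 0 y" "x \<noteq> y"
    then show False
      using separated[of x y] eucl_dist_le_if_grid_cell_eq[OF w(1), of d 0 x y] w(2) by auto
  qed
  have "grid_cell d w 0 ` F \<subseteq> PiE {..<d} I"
    unfolding grid_cell_def I_def using box w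
    by (intro image_subsetI restrict_PiE_iff[THEN iffD2])
      (auto intro!: floor_mono divide_right_mono)
  then have "card F \<le> card (PiE {..<d} I)"
    by (intro card_inj_on_le[OF inj]) (auto simp: I_def intro!: finite_PiE)
  then have "real (card F) \<le> (\<Prod>i<d. real (card (I i)))"
    by (metis card_PiE finite_lessThan of_nat_le_iff of_nat_prod)
  also have "\<dots> \<le> (\<Prod>i<d. W / w + 2)"
  proof (rule prod_mono)
    fix i
    have "0 \<le> W / w" using w assms by simp
    moreover have "(p i + W) / w = p i / w + W / w" by (rule add_divide_distrib)
    ultimately show "0 \<le> real (card (I i)) \<and> real (card (I i)) \<le> W / w + 2"
      unfolding I_def card_atLeastAtMost_int by linarith
  qed
  also have "\<dots> = (W * real d / r + 2) ^ d" by (simp add: w_def)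
  finally show ?thesis .
qed

lemma card_separated_in_grid_cell:
  assumes "finite F" "0 < r" "0 < W" "0 < d"
    and "\<And>x y. x \<in> F \<Longrightarrow> y \<in> F \<Longrightarrow> x \<noteq> y \<Longrightarrow> r < eucl_dist d x y"
    and cell: "\<And>x. x \<in> F \<Longrightarrow> grid_cell d W s x = c"
  shows "real (card F) \<le> (W * real d / r + 2) ^ d"
proof (rule card_separated_in_box[where p = "\<lambda>i. W * (real_of_int (c i) - s)"])
  fix x i assume "x \<in> F" "i < d"
  then have "\<lfloor>x i / W + s\<rfloor> = c i" using cell[of x, symmetric] by (simp add: grid_cell_def)
  then have "real_of_int (c i) - s \<le> x i / W" "x i / W \<le> real_of_int (c i) - s + 1" by linarith+
  then have "W * (real_of_int (c i) - s) \<le> x i" "x i \<le> W * (real_of_int (c i) - s + 1)"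
    using assms(3) by (simp_all only: pos_le_divide_eq pos_divide_le_eq mult.commute)
  then show "W * (real_of_int (c i) - s) \<le> x i \<and> x i \<le> W * (real_of_int (c i) - s) + W"
    by (simp add: algebra_simps)
qed (use assms in auto)

lemma card_grid_cell_shift_neq:
  assumes "0 < M" "0 < W"
  shows "real (card {q\<in>{..<M}.
      grid_cell d W (real q / real M) x \<noteq> grid_cell d W (real q / real M) y})
    \<le> real d * (real M * (eucl_dist d x y / W) + 1)" (is "real (card ?Q) \<le> _")
proof -
  let ?Q' = "\<lambda>i. {q\<in>{..<M}. \<lfloor>x i / W + real q / real M\<rfloor> \<noteq> \<lfloor>y i / W + real q / real M\<rfloor>}"
  have "?Q \<subseteq> (\<Union>i<d. ?Q' i)" by (auto simp: grid_cell_eq_iff)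
  then have "card ?Q \<le> card (\<Union>i<d. ?Q' i)" by (intro card_mono) auto
  also have "\<dots> \<le> (\<Sum>i<d. card (?Q' i))" by (intro card_UN_le) auto
  finally have "real (card ?Q) \<le> (\<Sum>i<d. real (card (?Q' i)))"
    unfolding of_nat_sum[symmetric] by (rule of_nat_mono)
  also have "\<dots> \<le> (\<Sum>i<d. real M * (eucl_dist d x y / W) + 1)"
  proof (rule sum_mono)
    fix i assume "i \<in> {..<d}"
    then have "\<bar>x i - y i\<bar> / W \<le> eucl_dist d x y / W"
      using assms(2) abs_coordinate_diff_le_eucl_dist[of i d x y]
      by (intro divide_right_mono) auto
    then have "\<bar>x i / W - y i / W\<bar> \<le> eucl_dist d x y / W"
      using assms(2) by (simp add: diff_divide_distrib[symmetric])
    then have "real M * \<bar>x i / W - y i / W\<bar> \<le> real M * (eucl_dist d x y / W)"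
      by (rule mult_left_mono) simp
    with card_floor_shift_neq[OF assms(1), of "x i / W" "y i / W"]
    show "real (card (?Q' i)) \<le> real M * (eucl_dist d x y / W) + 1" by linarith
  qed
  finally show ?thesis by simp
qed

definition log_band :: "real \<Rightarrow> nat \<Rightarrow> nat \<Rightarrow> real \<Rightarrow> int" where
  "log_band b m h t = \<lfloor>log b t / real m + real h / real m\<rfloor>"

lemma
  assumes "1 < b" "0 < m" "0 < t"
  shows powr_log_band_le: "b powr (real m * real_of_int (log_band b m h t) - real h) \<le> t"
    and less_powr_log_band: "t < b powr (real m * (real_of_int (log_band b m h t) + 1) - real h)"
proof -
  define k where "k = log_band b m h t"
  have "real_of_int k \<le> (log b t + real h) / real m"
    "(log b t + real h) / real m < real_of_int k + 1"
    unfolding k_def log_band_def add_divide_distrib by linarith+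
  then have "real m * real_of_int k - real h \<le> log b t"
    "log b t < real m * (real_of_int k + 1) - real h"
    using assms(2) by (auto simp: field_simps)
  then show "b powr (real m * real_of_int k - real h) \<le> t"
    "t < b powr (real m * (real_of_int k + 1) - real h)"
    using assms(1,3) by (simp_all add: le_log_iff log_less_iff)
qed

lemma card_log_band_shift_neq:
  assumes "0 < m"
  shows "real (card {h\<in>{..<m}. log_band b m h s \<noteq> log_band b m h t}) \<le> \<bar>log b s - log b t\<bar> + 1"
proof -
  have "real m * \<bar>log b s / real m - log b t / real m\<bar> = \<bar>log b s - log b t\<bar>"
    using assms by (simp add: diff_divide_distrib[symmetric])
  with card_floor_shift_neq[OF assms, of "log b s / real m" "log b t / real m"]
  show ?thesis unfolding log_band_def by simp
qed

subsection \<open>Linked labelings\<close>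

definition linked ::
  "('a \<Rightarrow> 'a \<Rightarrow> real) \<Rightarrow> 'a set \<Rightarrow> 'a set \<Rightarrow> ('a \<Rightarrow> 'l) \<Rightarrow> real \<Rightarrow> 'a \<Rightarrow> 'a \<Rightarrow> bool" where
  "linked \<delta> A B f \<tau> a b \<longleftrightarrow>
    (\<exists>s\<in>A. \<exists>t\<in>B. f s = f t \<and> (\<forall>v\<in>{s, t}. min (\<delta> v a) (\<delta> v b) \<le> \<tau> * \<delta> a b))"

lemma linked_comp:
  assumes "linked \<delta> A B f \<tau> a b"
  shows "linked \<delta> A B (g \<circ> f) \<tau> a b"
  using assms unfolding linked_def comp_apply by metis

text \<open>
  Think of \<open>\<omega>\<close> as uniformly distributed over \<open>\<Omega>\<close>: the last assumption says that a given pair fails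
  to be linked at distance \<open>\<tau>\<close> with probability at most \<open>p\<close>.
\<close>

locale linked_family =
  fixes \<delta> :: "'a \<Rightarrow> 'a \<Rightarrow> real" and A B :: "'a set" and \<rho> \<sigma> \<tau> p :: real
    and \<Omega> :: "'i set" and f :: "'i \<Rightarrow> 'a \<Rightarrow> 'l"
  assumes nonneg: "0 \<le> \<sigma>" "0 \<le> \<tau>" "0 \<le> p"
    and finite_nonempty: "finite \<Omega>" "\<Omega> \<noteq> {}"
    and balanced: "\<omega> \<in> \<Omega> \<Longrightarrow> balanced_labeling A B \<rho> (f \<omega>)"
    and always_linked: "\<omega> \<in> \<Omega> \<Longrightarrow> a \<in> A \<Longrightarrow> b \<in> B \<Longrightarrow> linked \<delta> A B (f \<omega>) \<sigma> a b"
    and mostly_linked: "a \<in> A \<Longrightarrow> b \<in> B \<Longrightarrow>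
      real (card {\<omega>\<in>\<Omega>. \<not> linked \<delta> A B (f \<omega>) \<tau> a b}) \<le> p * real (card \<Omega>)"

subsection \<open>Nets and anchored pairs\<close>

locale bichromatic = Metric_space U \<delta> for U :: "'a set" and \<delta> +
  fixes A B :: "'a set"
  assumes finite_A: "finite A" and finite_B: "finite B" and empty_iff: "A = {} \<longleftrightarrow> B = {}"
    and disjoint: "A \<inter> B = {}" and in_space: "A \<union> B \<subseteq> U"
begin

abbreviation "V \<equiv> A \<union> B"

lemma finite_V [simp]: "finite V"
  using finite_A finite_B by simp

lemma V_triangle: "u \<in> V \<Longrightarrow> v \<in> V \<Longrightarrow> w \<in> V \<Longrightarrow> \<delta> u w \<le> \<delta> u v + \<delta> v w"
  using in_space by (intro triangle) auto

definition opposite :: "'a \<Rightarrow> 'a set" where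
  "opposite v = (if v \<in> A then B else A)"

definition nearest :: "'a \<Rightarrow> 'a" where
  "nearest v = arg_min_on (\<delta> v) (opposite v)"

definition opp_dist :: "'a \<Rightarrow> real" where
  "opp_dist v = \<delta> v (nearest v)"

lemma opposite_finite_nonempty:
  assumes "v \<in> V"
  shows "finite (opposite v)" "opposite v \<noteq> {}"
  using assms finite_A finite_B empty_iff by (auto simp: opposite_def)

lemma nearest_in_opposite: "v \<in> V \<Longrightarrow> nearest v \<in> opposite v"
  unfolding nearest_def by (intro arg_min_if_finite opposite_finite_nonempty)

lemma opp_dist_le: "v \<in> V \<Longrightarrow> w \<in> opposite v \<Longrightarrow> opp_dist v \<le> \<delta> v w"
  unfolding opp_dist_def nearest_def by (intro arg_min_least opposite_finite_nonempty)

lemma nearest_in_V: "v \<in> V \<Longrightarrow> nearest v \<in> V"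
  using nearest_in_opposite[of v] by (auto simp: opposite_def split: if_splits)

lemma nearest_mem_A_iff: "v \<in> V \<Longrightarrow> nearest v \<in> A \<longleftrightarrow> v \<notin> A"
  using nearest_in_opposite[of v] disjoint by (auto simp: opposite_def split: if_splits)

lemma nearest_neq: "v \<in> V \<Longrightarrow> nearest v \<noteq> v"
  using nearest_mem_A_iff by metis

lemma opp_dist_nearest_le: "v \<in> V \<Longrightarrow> opp_dist (nearest v) \<le> opp_dist v"
  using opp_dist_le[of "nearest v" v] nearest_in_V[of v] nearest_mem_A_iff[of v]
  by (auto simp: opposite_def opp_dist_def[of v] commute)

lemma opp_dist_pos: "v \<in> V \<Longrightarrow> 0 < opp_dist v"
  unfolding opp_dist_def using nearest_neq[of v] nearest_in_V[of v] in_space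
  by (intro mdist_pos_less) auto

lemma opp_dist_pair_le:
  assumes "a \<in> A" "b \<in> B"
  shows "opp_dist a \<le> \<delta> a b" "opp_dist b \<le> \<delta> a b"
proof -
  have "b \<notin> A" using assms(2) disjoint by auto
  then show "opp_dist a \<le> \<delta> a b" "opp_dist b \<le> \<delta> a b"
    using opp_dist_le[of a b] opp_dist_le[of b a] assms by (simp_all add: opposite_def commute)
qed

lemma opp_dist_lipschitz:
  assumes "u \<in> V" "v \<in> V" "u \<in> A \<longleftrightarrow> v \<in> A"
  shows "opp_dist u \<le> \<delta> u v + opp_dist v"
proof -
  have "opp_dist u \<le> \<delta> u (nearest v)"
    using opp_dist_le[of u "nearest v"] nearest_in_opposite[of v] assms by (simp add: opposite_def)
  also have "\<dots> \<le> \<delta> u v + \<delta> v (nearest v)" using assms nearest_in_V by (intro V_triangle) auto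
  finally show ?thesis by (simp add: opp_dist_def)
qed

definition is_net :: "real \<Rightarrow> 'a set \<Rightarrow> bool" where
  "is_net \<kappa> E \<longleftrightarrow> E \<subseteq> V \<and> (\<forall>v\<in>V. \<exists>u\<in>E. opp_dist u \<le> opp_dist v \<and> \<delta> v u \<le> \<kappa> * opp_dist v) \<and>
    (\<forall>u\<in>E. \<forall>v\<in>E. u \<noteq> v \<longrightarrow> \<kappa> * opp_dist u < \<delta> u v)"

definition net :: "real \<Rightarrow> 'a set" where
  "net \<kappa> = (SOME E. is_net \<kappa> E)"

lemma is_net_net:
  assumes "0 \<le> \<kappa>"
  shows "is_net \<kappa> (net \<kappa>)"
proof -
  let ?R = "\<lambda>v u. v = u \<or> \<delta> v u \<le> \<kappa> * opp_dist v"
  obtain E where E_subset: "E \<subseteq> V"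
    and covers: "\<forall>v\<in>V. \<exists>u\<in>E. opp_dist u \<le> opp_dist v \<and> ?R v u"
    and separated: "\<forall>u\<in>E. \<forall>v\<in>E. u \<noteq> v \<longrightarrow>
      (opp_dist u \<le> opp_dist v \<and> \<not> ?R v u) \<or> (opp_dist v \<le> opp_dist u \<and> \<not> ?R u v)"
    using exists_greedy_net[OF finite_V, of ?R opp_dist, OF disjI1[OF refl]]
    by (elim exE conjE) (rule that)
  have "\<exists>u\<in>E. opp_dist u \<le> opp_dist v \<and> \<delta> v u \<le> \<kappa> * opp_dist v" if "v \<in> V" for v
  proof -
    have "\<delta> v v = 0" "0 \<le> \<kappa> * opp_dist v" using assms opp_dist_pos[OF that] that in_space by auto
    with covers that show ?thesis by fastforce
  qed
  moreover have "\<kappa> * opp_dist u < \<delta> u v" if "u \<in> E" "v \<in> E" "u \<noteq> v" for u v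
  proof -
    have "opp_dist u \<le> opp_dist v \<Longrightarrow> \<kappa> * opp_dist u \<le> \<kappa> * opp_dist v"
      using assms by (auto intro: mult_left_mono)
    moreover have "\<delta> u v = \<delta> v u" by (rule commute)
    moreover have "(opp_dist u \<le> opp_dist v \<and> \<not> ?R v u) \<or> (opp_dist v \<le> opp_dist u \<and> \<not> ?R u v)"
      using separated that by blast
    ultimately show ?thesis by linarith
  qed
  ultimately have "is_net \<kappa> E" using E_subset by (simp add: is_net_def)
  then show ?thesis unfolding net_def by (rule someI)
qed

lemma net_subset: "0 \<le> \<kappa> \<Longrightarrow> net \<kappa> \<subseteq> V"
  using is_net_net by (auto simp: is_net_def)

lemma net_covers:
  assumes "0 \<le> \<kappa>" "v \<in> V"
  obtains u where "u \<in> net \<kappa>" "opp_dist u \<le> opp_dist v" "\<delta> v u \<le> \<kappa> * opp_dist v"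
proof -
  have "\<forall>v\<in>V. \<exists>u\<in>net \<kappa>. opp_dist u \<le> opp_dist v \<and> \<delta> v u \<le> \<kappa> * opp_dist v"
    using is_net_net[OF assms(1)] by (simp add: is_net_def)
  with assms(2) that show ?thesis by blast
qed

lemma net_separated:
  assumes "0 \<le> \<kappa>" "u \<in> net \<kappa>" "v \<in> net \<kappa>" "u \<noteq> v"
  shows "\<kappa> * opp_dist u < \<delta> u v"
  using is_net_net[OF assms(1)] assms(2-) by (simp add: is_net_def)

lemma net_representative:
  assumes "0 \<le> \<kappa>" "\<kappa> \<le> 1 / 2" "v \<in> V"
  obtains u where "u \<in> net \<kappa>" "u \<in> A \<longleftrightarrow> v \<in> A" "opp_dist u \<le> opp_dist v"
    "opp_dist v \<le> 2 * opp_dist u" "\<delta> v u \<le> \<kappa> * opp_dist v"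
proof -
  obtain u where u: "u \<in> net \<kappa>" "opp_dist u \<le> opp_dist v" "\<delta> v u \<le> \<kappa> * opp_dist v"
    using net_covers assms(1,3) by blast
  have "u \<in> V" using u(1) net_subset[OF assms(1)] by blast
  have "\<kappa> * opp_dist v \<le> 1 / 2 * opp_dist v"
    using assms opp_dist_pos[of v] by (intro mult_right_mono) auto
  then have close: "\<delta> v u \<le> opp_dist v / 2" using u(3) by simp
  then have "u \<notin> opposite v"
    using opp_dist_le[OF assms(3), of u] opp_dist_pos[OF assms(3)] by auto
  then have same_side: "u \<in> A \<longleftrightarrow> v \<in> A"
    using \<open>u \<in> V\<close> assms(3) disjoint by (auto simp: opposite_def split: if_splits)
  then have "opp_dist v \<le> \<delta> v u + opp_dist u"
    using opp_dist_lipschitz[OF assms(3) \<open>u \<in> V\<close>] by simp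
  then show ?thesis using that[OF u(1) same_side u(2) _ u(3)] close by simp
qed

abbreviation "anchors \<equiv> net 2"

lemma anchors_in_V: "u \<in> anchors \<Longrightarrow> u \<in> V"
  using net_subset[of 2] by auto

lemma anchors_separated: "u \<in> anchors \<Longrightarrow> v \<in> anchors \<Longrightarrow> u \<noteq> v \<Longrightarrow> 2 * opp_dist u < \<delta> u v"
  by (intro net_separated) auto

lemma nearest_anchor_notin_anchors:
  assumes "u \<in> anchors"
  shows "nearest u \<notin> anchors"
proof
  assume "nearest u \<in> anchors"
  then have "2 * opp_dist u < opp_dist u"
    using anchors_separated[of u "nearest u"] assms nearest_neq[OF anchors_in_V[OF assms]]
    by (simp add: opp_dist_def)
  then show False using opp_dist_pos[OF anchors_in_V[OF assms]] by simp
qed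

lemma inj_on_nearest_anchors: "inj_on nearest anchors"
proof (rule inj_onI, rule ccontr)
  fix u v assume uv: "u \<in> anchors" "v \<in> anchors" "nearest u = nearest v" "u \<noteq> v"
  have "\<delta> u v \<le> \<delta> u (nearest u) + \<delta> (nearest v) v"
    using V_triangle[of u "nearest u" v] uv anchors_in_V nearest_in_V by simp
  then have "\<delta> u v \<le> opp_dist u + opp_dist v" by (simp add: opp_dist_def commute)
  moreover have "2 * opp_dist u < \<delta> u v" "2 * opp_dist v < \<delta> u v"
    using anchors_separated uv commute[of u v] by metis+
  ultimately show False by linarith
qed

lemma opp_dist_anchor_le:
  assumes "u \<in> anchors"
  shows "opp_dist u \<le> 2 * opp_dist (nearest u)"
proof (rule ccontr)
  assume contr: "\<not> ?thesis"
  have V: "u \<in> V" "nearest u \<in> V" using assms anchors_in_V nearest_in_V by auto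
  obtain x where x: "x \<in> anchors" "opp_dist x \<le> opp_dist (nearest u)"
    "\<delta> (nearest u) x \<le> 2 * opp_dist (nearest u)"
    using net_covers[of 2 "nearest u"] V by auto
  have "x \<noteq> u" using contr x(2) opp_dist_pos[OF V(2)] by auto
  then have "2 * opp_dist u < \<delta> u x" using anchors_separated assms x(1) by metis
  also have "\<dots> \<le> \<delta> u (nearest u) + \<delta> (nearest u) x"
    using V anchors_in_V[OF x(1)] by (intro V_triangle)
  also have "\<dots> \<le> opp_dist u + 2 * opp_dist (nearest u)" using x(3) by (simp add: opp_dist_def)
  finally show False using contr by linarith
qed

text \<open>
  The partner \<open>nearest u\<close> of an anchor \<open>u\<close> is keyed by \<open>u\<close> itself, so that no block separates the
  pair.
\<close>

definition anchor :: "'a \<Rightarrow> 'a" where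
  "anchor v = (if v \<in> nearest ` anchors then inv_into anchors nearest v else v)"

lemma anchor_nearest: "u \<in> anchors \<Longrightarrow> anchor (nearest u) = u"
  by (simp add: anchor_def inj_on_nearest_anchors)

lemma anchor_anchor: "u \<in> anchors \<Longrightarrow> anchor u = u"
  using nearest_anchor_notin_anchors by (auto simp: anchor_def)

lemma anchor_cases:
  obtains (partner) u where "u \<in> anchors" "v = nearest u" "anchor v = u"
    | (self) "v \<notin> nearest ` anchors" "anchor v = v"
proof (cases "v \<in> nearest ` anchors")
  case True
  then show ?thesis using partner anchor_nearest by blast
next
  case False
  then show ?thesis using self by (simp add: anchor_def)
qed

lemma anchor_bounds:
  assumes "v \<in> V"
  shows "anchor v \<in> V" "opp_dist v \<le> opp_dist (anchor v)" "opp_dist (anchor v) \<le> 2 * opp_dist v"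
    "\<delta> v (anchor v) \<le> 2 * opp_dist v"
proof -
  have "anchor v \<in> V \<and> opp_dist v \<le> opp_dist (anchor v) \<and> opp_dist (anchor v) \<le> 2 * opp_dist v \<and>
    \<delta> v (anchor v) \<le> 2 * opp_dist v"
  proof (cases v rule: anchor_cases)
    case (partner u)
    have "u \<in> V" using partner(1) by (rule anchors_in_V)
    moreover have "\<delta> v u = opp_dist u" using partner(2) by (simp add: opp_dist_def commute)
    ultimately show ?thesis
      using partner opp_dist_nearest_le[of u] opp_dist_anchor_le[OF partner(1)] by simp
  next
    case self
    moreover have "\<delta> v v = 0" using assms in_space by auto
    ultimately show ?thesis using assms opp_dist_pos[OF assms] by simp
  qed
  then show "anchor v \<in> V" "opp_dist v \<le> opp_dist (anchor v)"
    "opp_dist (anchor v) \<le> 2 * opp_dist v" "\<delta> v (anchor v) \<le> 2 * opp_dist v"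
    by auto
qed

definition essential :: "real \<Rightarrow> 'a set" where
  "essential \<kappa> = net \<kappa> \<union> anchors \<union> nearest ` anchors"

definition block :: "real \<Rightarrow> ('a \<Rightarrow> 'k) \<Rightarrow> 'a \<Rightarrow> 'k + 'a" where
  "block \<kappa> key v = (if v \<in> essential \<kappa> then Inl (key (anchor v)) else Inr v)"

lemma card_block_le:
  assumes "0 \<le> \<kappa>" "1 \<le> \<beta>"
    and cards: "\<And>x. real (card {v \<in> net \<kappa>. key v = x}) \<le> \<beta>"
      "\<And>x. real (card {v \<in> anchors. key v = x}) \<le> \<beta>"
  shows "real (card {v\<in>V. block \<kappa> key v = y}) \<le> 3 * \<beta>"
proof (cases y)
  case (Inr w)
  then have "{v\<in>V. block \<kappa> key v = y} \<subseteq> {w}" by (auto simp: block_def split: if_splits)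
  then have "card {v\<in>V. block \<kappa> key v = y} \<le> 1" using card_mono[of "{w}"] by fastforce
  then show ?thesis using assms(2) by linarith
next
  case (Inl x)
  define fibre where "fibre E = {v\<in>E. key v = x}" for E
  have fin: "finite (fibre (net \<kappa>))" "finite (fibre anchors)"
    using net_subset[of \<kappa>] net_subset[of 2] assms(1) unfolding fibre_def
    by (auto intro!: finite_subset[OF _ finite_V])
  have "{v\<in>V. block \<kappa> key v = y} \<subseteq> fibre (net \<kappa>) \<union> fibre anchors \<union> nearest ` fibre anchors"
  proof
    fix v assume "v \<in> {v\<in>V. block \<kappa> key v = y}"
    then have v: "v \<in> essential \<kappa>" "key (anchor v) = x"
      using Inl by (auto simp: block_def split: if_splits)
    show "v \<in> fibre (net \<kappa>) \<union> fibre anchors \<union> nearest ` fibre anchors"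
      using v by (cases v rule: anchor_cases) (auto simp: fibre_def essential_def)
  qed
  then have "card {v\<in>V. block \<kappa> key v = y}
    \<le> card (fibre (net \<kappa>) \<union> fibre anchors \<union> nearest ` fibre anchors)"
    using fin by (intro card_mono) auto
  also have "\<dots> \<le> card (fibre (net \<kappa>)) + card (fibre anchors) + card (fibre anchors)"
    using card_Un_le[of "fibre (net \<kappa>) \<union> fibre anchors" "nearest ` fibre anchors"]
      card_Un_le[of "fibre (net \<kappa>)" "fibre anchors"] card_image_le[OF fin(2), of nearest]
    by linarith
  finally show ?thesis using cards[of x] unfolding fibre_def by linarith
qed

lemma unseparated_pair_near:
  assumes "v \<in> V"
  obtains s t where "s \<in> A" "t \<in> B" "block \<kappa> key s = block \<kappa> key t"
    "\<delta> s v \<le> 3 * opp_dist v" "\<delta> t v \<le> 3 * opp_dist v"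
proof -
  obtain u where u: "u \<in> anchors" "opp_dist u \<le> opp_dist v" "\<delta> v u \<le> 2 * opp_dist v"
    using net_covers[of 2 v] assms by auto
  have "u \<in> V" using u(1) by (rule anchors_in_V)
  have same_block: "block \<kappa> key u = block \<kappa> key (nearest u)"
    using u(1) anchor_anchor anchor_nearest by (auto simp: block_def essential_def)
  have "\<delta> v (nearest u) \<le> \<delta> v u + \<delta> u (nearest u)"
    using assms \<open>u \<in> V\<close> nearest_in_V by (intro V_triangle)
  then have near: "\<delta> (nearest u) v \<le> 3 * opp_dist v" "\<delta> u v \<le> 3 * opp_dist v"
    using u opp_dist_pos[OF assms] by (auto simp: opp_dist_def commute[of v])
  show ?thesis
  proof (cases "u \<in> A")
    case True
    then have "nearest u \<in> B" using nearest_in_opposite[OF \<open>u \<in> V\<close>] by (simp add: opposite_def)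
    with True show ?thesis using that[of u "nearest u"] same_block near by blast
  next
    case False
    then have "nearest u \<in> A" "u \<in> B" using nearest_mem_A_iff \<open>u \<in> V\<close> by auto
    then show ?thesis using that[of "nearest u" u] same_block near by metis
  qed
qed

lemma linked_block_if_opp_dist_le:
  assumes "a \<in> A" "b \<in> B" "v \<in> {a, b}" "3 * opp_dist v \<le> \<tau> * \<delta> a b"
  shows "linked \<delta> A B (block \<kappa> key) \<tau> a b"
proof -
  have "v \<in> V" using assms(1-3) by auto
  then obtain s t where "s \<in> A" "t \<in> B" "block \<kappa> key s = block \<kappa> key t"
    "\<delta> s v \<le> 3 * opp_dist v" "\<delta> t v \<le> 3 * opp_dist v"
    by (rule unseparated_pair_near)
  moreover from this(4,5) assms(3,4)
  have "min (\<delta> s a) (\<delta> s b) \<le> \<tau> * \<delta> a b" "min (\<delta> t a) (\<delta> t b) \<le> \<tau> * \<delta> a b" by auto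
  ultimately show ?thesis unfolding linked_def by auto
qed

lemma linked_block_if_key_eq:
  assumes "0 \<le> \<kappa>" "a \<in> A" "b \<in> B" "s \<in> net \<kappa>" "t \<in> net \<kappa>" "s \<in> A" "t \<in> B"
    and "\<delta> a s \<le> \<kappa> * opp_dist a" "\<delta> b t \<le> \<kappa> * opp_dist b"
    and "key (anchor s) = key (anchor t)"
  shows "linked \<delta> A B (block \<kappa> key) \<kappa> a b"
proof -
  have "\<kappa> * opp_dist a \<le> \<kappa> * \<delta> a b" "\<kappa> * opp_dist b \<le> \<kappa> * \<delta> a b"
    using opp_dist_pair_le[OF assms(2,3)] assms(1) by (auto intro: mult_left_mono)
  then have "\<delta> s a \<le> \<kappa> * \<delta> a b" "\<delta> t b \<le> \<kappa> * \<delta> a b"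
    using assms(8,9) by (simp_all add: commute)
  moreover have "block \<kappa> key s = block \<kappa> key t"
    using assms(4,5,10) by (simp add: block_def essential_def)
  ultimately show ?thesis
    unfolding linked_def using assms(6,7) by (intro bexI[of _ s] bexI[of _ t]) auto
qed

lemma linking_keys:
  assumes "0 \<le> \<kappa>" "\<kappa> \<le> 1 / 2" "a \<in> A" "b \<in> B"
    and far: "\<kappa> * \<delta> a b < 3 * opp_dist a" "\<kappa> * \<delta> a b < 3 * opp_dist b"
  obtains x y where "x \<in> V" "y \<in> V"
    "\<kappa> * \<delta> a b \<le> 6 * opp_dist x" "opp_dist x \<le> 2 * \<delta> a b"
    "\<kappa> * \<delta> a b \<le> 6 * opp_dist y" "opp_dist y \<le> 2 * \<delta> a b" "\<delta> x y \<le> 7 * \<delta> a b"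
    "\<And>key :: 'a \<Rightarrow> 'k. key x = key y \<Longrightarrow> linked \<delta> A B (block \<kappa> key) \<kappa> a b"
proof -
  have V: "a \<in> V" "b \<in> V" using assms(3,4) by auto
  obtain s where s: "s \<in> net \<kappa>" "s \<in> A \<longleftrightarrow> a \<in> A" "opp_dist s \<le> opp_dist a"
    "opp_dist a \<le> 2 * opp_dist s" "\<delta> a s \<le> \<kappa> * opp_dist a"
    using net_representative[OF assms(1,2) V(1)] by blast
  obtain t where t: "t \<in> net \<kappa>" "t \<in> A \<longleftrightarrow> b \<in> A" "opp_dist t \<le> opp_dist b"
    "opp_dist b \<le> 2 * opp_dist t" "\<delta> b t \<le> \<kappa> * opp_dist b"
    using net_representative[OF assms(1,2) V(2)] by blast
  have st: "s \<in> A" "t \<in> B" using s(1,2) t(1,2) assms(3,4) disjoint net_subset[OF assms(1)] by auto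
  then have sV: "s \<in> V" and tV: "t \<in> V" by auto
  note x = anchor_bounds[OF sV] and y = anchor_bounds[OF tV]
  note opp_dist_ab = opp_dist_pair_le[OF assms(3,4)] opp_dist_pos[OF V(1)] opp_dist_pos[OF V(2)]
  have "\<kappa> * opp_dist a \<le> 1 / 2 * opp_dist a" "\<kappa> * opp_dist b \<le> 1 / 2 * opp_dist b"
    using assms(2) opp_dist_ab by (auto intro: mult_right_mono simp del: times_divide_eq_left)
  then have "\<delta> a s \<le> \<delta> a b / 2" "\<delta> b t \<le> \<delta> a b / 2" using s(5) t(5) opp_dist_ab by linarith+
  moreover have "\<delta> (anchor s) (anchor t)
    \<le> \<delta> s (anchor s) + \<delta> a s + \<delta> a b + \<delta> b t + \<delta> t (anchor t)"
    using V_triangle[OF x(1) sV y(1)] V_triangle[OF sV V(1) y(1)] V_triangle[OF V y(1)]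
      V_triangle[OF V(2) tV y(1)] commute[of s "anchor s"] commute[of a s] by linarith
  ultimately have near: "\<delta> (anchor s) (anchor t) \<le> 7 * \<delta> a b"
    using x(4) y(4) s(3) t(3) opp_dist_ab by linarith
  have "linked \<delta> A B (block \<kappa> key) \<kappa> a b" if "key (anchor s) = key (anchor t)" for key :: "'a \<Rightarrow> 'k"
    using linked_block_if_key_eq[OF assms(1,3,4) s(1) t(1) st s(5) t(5) that] .
  with x y s(3,4) t(3,4) far opp_dist_ab near show ?thesis
    by (intro that[of "anchor s" "anchor t"]) auto
qed

end

subsection \<open>Random blocks in Euclidean space\<close>

locale euclidean_bichromatic =
  bichromatic "topspace (Euclidean_space d)" "eucl_dist d" A B for d A B +
  fixes \<epsilon> :: real
  assumes dim: "0 < d" and eps_pos: "0 < \<epsilon>" and eps_small: "\<epsilon> \<le> 1 / 42"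
begin

definition base :: real where "base = 1 / \<epsilon>"

definition band_shifts :: nat where "band_shifts = nat \<lceil>base\<rceil>"

definition cell_shifts :: nat where "cell_shifts = nat \<lceil>real d * base\<rceil>"

lemma base_ge: "42 \<le> base"
  using eps_pos eps_small by (simp add: base_def field_simps)

lemma band_shifts_bounds: "0 < band_shifts" "base \<le> real band_shifts" "real band_shifts \<le> base + 1"
  using base_ge unfolding band_shifts_def by linarith+

lemma cell_shifts_bounds: "0 < cell_shifts" "real d * base \<le> real cell_shifts"
proof -
  have "0 < real d * base" using dim base_ge by simp
  then show "0 < cell_shifts" "real d * base \<le> real cell_shifts"
    unfolding cell_shifts_def by linarith+
qed

definition band :: "nat \<Rightarrow> (nat \<Rightarrow> real) \<Rightarrow> int" where
  "band h v = log_band base band_shifts h (opp_dist v)"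

definition band_floor :: "nat \<Rightarrow> int \<Rightarrow> real" where
  "band_floor h k = base powr (real band_shifts * real_of_int k - real h)"

definition cell_width :: "nat \<Rightarrow> int \<Rightarrow> real" where
  "cell_width h k = real d * base ^ 3 * band_floor h (k + 1)"

definition cell :: "nat \<Rightarrow> nat \<Rightarrow> (nat \<Rightarrow> real) \<Rightarrow> nat \<Rightarrow> int" where
  "cell h q v = grid_cell d (cell_width h (band h v)) (real q / real cell_shifts) v"

definition bucket :: "nat \<Rightarrow> nat \<Rightarrow> (nat \<Rightarrow> real) \<Rightarrow> int \<times> (nat \<Rightarrow> int)" where
  "bucket h q v = (band h v, cell h q v)"

lemma band_floor_pos: "0 < band_floor h k"
  using base_ge by (simp add: band_floor_def)

lemma cell_width_pos: "0 < cell_width h k"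
  using dim base_ge band_floor_pos by (simp add: cell_width_def)

lemma band_floor_Suc: "band_floor h (k + 1) = band_floor h k * base ^ band_shifts"
proof -
  have "base ^ band_shifts = base powr real band_shifts" using base_ge by (simp add: powr_realpow)
  then show ?thesis by (simp add: band_floor_def powr_add[symmetric] algebra_simps)
qed

lemma band_floor_le_opp_dist: "v \<in> V \<Longrightarrow> band_floor h (band h v) \<le> opp_dist v"
  using powr_log_band_le[of base band_shifts "opp_dist v"] base_ge band_shifts_bounds(1)
    opp_dist_pos by (simp add: band_floor_def band_def)

lemma opp_dist_less_band_floor: "v \<in> V \<Longrightarrow> opp_dist v < band_floor h (band h v + 1)"
  using less_powr_log_band[of base band_shifts "opp_dist v"] base_ge band_shifts_bounds(1)
    opp_dist_pos by (simp add: band_floor_def band_def)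

definition cell_bound :: real where
  "cell_bound = ((real d)\<^sup>2 * base ^ (band_shifts + 4) + 2) ^ d"

lemma cell_bound_ge_1: "1 \<le> cell_bound"
  unfolding cell_bound_def using base_ge by (intro one_le_power) (simp add: add_increasing)

lemma card_net_bucket_le:
  assumes "\<epsilon> \<le> \<kappa>"
  shows "real (card {v \<in> net \<kappa>. bucket h q v = x}) \<le> cell_bound"
proof -
  obtain k c where x: "x = (k, c)" by fastforce
  define F where "F = {v \<in> net \<kappa>. bucket h q v = x}"
  define r where "r = band_floor h k"
  define W where "W = cell_width h k"
  have pos: "0 < r" "0 < W" "0 \<le> \<kappa>"
    using assms eps_pos by (simp_all add: r_def W_def band_floor_pos cell_width_pos)
  have F: "v \<in> V" "v \<in> net \<kappa>" "band h v = k" "cell h q v = c" if "v \<in> F" for v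
    using that net_subset[OF pos(3)] by (auto simp: F_def bucket_def x)
  have "real (card F) \<le> (W * real d / (\<epsilon> * r) + 2) ^ d"
  proof (rule card_separated_in_grid_cell)
    show "finite F" using F(1) by (intro finite_subset[OF _ finite_V]) auto
    show "0 < \<epsilon> * r" "0 < W" "0 < d" using pos eps_pos dim by auto
    show "grid_cell d W (real q / real cell_shifts) v = c" if "v \<in> F" for v
      using F(3,4)[OF that] by (simp add: cell_def W_def)
    fix u v assume uv: "u \<in> F" "v \<in> F" "u \<noteq> v"
    have "\<epsilon> * r \<le> \<kappa> * opp_dist u"
      using band_floor_le_opp_dist[OF F(1)[OF uv(1)], of h] F(3)[OF uv(1)] assms pos eps_pos
      by (intro mult_mono) (auto simp: r_def)
    also have "\<dots> < eucl_dist d u v" using net_separated[OF pos(3)] F(2) uv by auto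
    finally show "\<epsilon> * r < eucl_dist d u v" .
  qed
  also have "W * real d / (\<epsilon> * r) = (real d)\<^sup>2 * base ^ (band_shifts + 4)"
    using pos(1) eps_pos
    by (simp add: W_def cell_width_def band_floor_Suc r_def base_def power_add power2_eq_square
        power3_eq_cube power4_eq_xxxx mult_ac)
  finally show ?thesis by (simp add: cell_bound_def F_def)
qed

lemma cell_bound_squared_le:
  "cell_bound\<^sup>2 \<le> (2 * real d) ^ (8 * d) * base powr (36 * real d * base)"
proof -
  define P where "P = base ^ (band_shifts + 4)"
  have d: "1 \<le> real d" using dim by simp
  have "base \<le> P" unfolding P_def using base_ge by (intro self_le_power) auto
  then have "1 * 2 \<le> (real d)\<^sup>2 * P" using d base_ge by (intro mult_mono one_le_power) auto
  then have "cell_bound \<le> (2 * (real d)\<^sup>2 * P) ^ d"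
    unfolding cell_bound_def P_def[symmetric] by (intro power_mono) linarith+
  then have "cell_bound\<^sup>2 \<le> ((2 * (real d)\<^sup>2 * P) ^ d)\<^sup>2"
    using cell_bound_ge_1 by (intro power_mono) auto
  also have "\<dots> = (2 * (real d)\<^sup>2) ^ (2 * d) * P ^ (2 * d)"
    by (metis power_mult power_mult_distrib mult.commute)
  also have "\<dots> \<le> (2 * real d) ^ (8 * d) * base powr (36 * real d * base)"
  proof (rule mult_mono)
    have "2 * (real d)\<^sup>2 \<le> (2 * real d)\<^sup>2" by (simp add: power_mult_distrib)
    also have "\<dots> \<le> (2 * real d) ^ 4" using d by (intro power_increasing) auto
    finally have "(2 * (real d)\<^sup>2) ^ (2 * d) \<le> ((2 * real d) ^ 4) ^ (2 * d)"
      by (rule power_mono) simp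
    then show "(2 * (real d)\<^sup>2) ^ (2 * d) \<le> (2 * real d) ^ (8 * d)"
      by (simp only: power_mult[symmetric]) simp
    have "(2 * real band_shifts + 8) * real d \<le> (36 * base) * real d"
      using band_shifts_bounds base_ge by (intro mult_right_mono) auto
    then have "real ((band_shifts + 4) * (2 * d)) \<le> 36 * real d * base"
      by (simp add: algebra_simps)
    then have "base powr real ((band_shifts + 4) * (2 * d)) \<le> base powr (36 * real d * base)"
      using base_ge by (intro powr_mono) auto
    then show "P ^ (2 * d) \<le> base powr (36 * real d * base)"
      using base_ge by (simp only: P_def power_mult[symmetric] powr_realpow)
  qed (use base_ge in \<open>auto simp: P_def\<close>)
  finally show ?thesis .
qed

lemma cell_bound_le_swap_size: "3 * (3 * cell_bound)\<^sup>2 \<le> swap_size d \<epsilon>"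
proof -
  have "3 * (3 * cell_bound)\<^sup>2 \<le> 32 * cell_bound\<^sup>2" by (simp add: power_mult_distrib)
  also have "\<dots> \<le> 32 * ((2 * real d) ^ (8 * d) * base powr (36 * real d * base))"
    using cell_bound_squared_le by simp
  also have "base powr (36 * real d * base) = \<epsilon> powr (- (36 * real d / \<epsilon>))"
    using eps_pos by (simp add: base_def powr_minus_divide powr_divide)
  finally show ?thesis by (simp add: swap_size_def)
qed

lemma exists_balanced_block_labeling:
  assumes "card A = card B"
  shows "\<exists>g :: _ \<Rightarrow> nat. balanced_labeling A B (swap_size d \<epsilon>) (g \<circ> block \<epsilon> (bucket h q))"
proof -
  define \<beta> where "\<beta> = nat \<lfloor>3 * cell_bound\<rfloor>"
  have \<beta>: "real \<beta> \<le> 3 * cell_bound" "1 \<le> \<beta>"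
    using cell_bound_ge_1 unfolding \<beta>_def by linarith+
  have "card {v\<in>V. block \<epsilon> (bucket h q) v = x} \<le> \<beta>" for x
  proof -
    have "real (card {v\<in>V. block \<epsilon> (bucket h q) v = x}) \<le> 3 * cell_bound"
      using card_net_bucket_le cell_bound_ge_1 eps_pos eps_small by (intro card_block_le) auto
    then show ?thesis unfolding \<beta>_def by linarith
  qed
  from exists_balanced_coarsening[OF finite_A finite_B assms this] obtain g :: "_ \<Rightarrow> nat"
    where g: "balanced_labeling A B (real ((2 * \<beta> + 1) * \<beta>)) (g \<circ> block \<epsilon> (bucket h q))" by blast
  have "real ((2 * \<beta> + 1) * \<beta>) \<le> 3 * real \<beta> * real \<beta>"
    using \<beta>(2) unfolding of_nat_mult by (intro mult_right_mono) auto
  also have "\<dots> \<le> 3 * (3 * cell_bound)\<^sup>2"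
    using power_mono[OF \<beta>(1), of 2] by (simp add: power2_eq_square)
  also have "\<dots> \<le> swap_size d \<epsilon>" by (rule cell_bound_le_swap_size)
  finally show ?thesis using balanced_labeling_mono[OF g] by blast
qed

lemma card_band_neq_le:
  assumes V: "x \<in> V" "y \<in> V"
    and ratio: "opp_dist x \<le> base\<^sup>2 * opp_dist y" "opp_dist y \<le> base\<^sup>2 * opp_dist x"
  shows "real (card {h\<in>{..<band_shifts}. band h x \<noteq> band h y}) \<le> 3"
proof -
  have log_le: "log base s \<le> 2 + log base t" if "0 < s" "0 < t" "s \<le> base\<^sup>2 * t" for s t
  proof -
    have "log base s \<le> log base (base\<^sup>2 * t)" using that base_ge by simp
    also have "\<dots> = 2 + log base t" using that base_ge by (simp add: log_mult log_nat_power)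
    finally show ?thesis .
  qed
  have "\<bar>log base (opp_dist x) - log base (opp_dist y)\<bar> \<le> 2"
    using log_le[OF _ _ ratio(1)] log_le[OF _ _ ratio(2)] opp_dist_pos V
    by (simp add: abs_le_iff diff_le_eq)
  then show ?thesis
    using card_log_band_shift_neq[OF band_shifts_bounds(1), of base "opp_dist x" "opp_dist y"]
    unfolding band_def by linarith
qed

lemma card_cell_neq_le:
  assumes "x \<in> V" "band h x = band h y" "eucl_dist d x y \<le> base\<^sup>2 * opp_dist x"
  shows "real (card {q\<in>{..<cell_shifts}. cell h q x \<noteq> cell h q y}) \<le> 2 * real cell_shifts / base"
proof -
  define W where "W = cell_width h (band h x)"
  define R where "R = band_floor h (band h x + 1)"
  have R: "0 < R" unfolding R_def by (rule band_floor_pos)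
  have pos: "0 < base" "0 < real d" using base_ge dim by auto
  have "eucl_dist d x y \<le> base\<^sup>2 * R"
    using assms(3) opp_dist_less_band_floor[OF assms(1), of h] pos
    unfolding R_def by (meson less_imp_le mult_left_mono order_trans zero_le_power2)
  then have "eucl_dist d x y / W \<le> base\<^sup>2 * R / W"
    by (intro divide_right_mono) (simp_all add: W_def less_imp_le cell_width_pos)
  also have "\<dots> = 1 / (real d * base)"
    using R pos by (simp add: W_def cell_width_def R_def power2_eq_square power3_eq_cube)
  finally have dist: "eucl_dist d x y / W \<le> 1 / (real d * base)" .
  have "real (card {q\<in>{..<cell_shifts}. cell h q x \<noteq> cell h q y})
    \<le> real d * (real cell_shifts * (eucl_dist d x y / W) + 1)"
    unfolding cell_def assms(2)[symmetric] W_def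
    by (rule card_grid_cell_shift_neq[OF cell_shifts_bounds(1) cell_width_pos])
  also have "\<dots> \<le> real d * (real cell_shifts * (1 / (real d * base)) + 1)"
    using dist by (intro mult_left_mono add_right_mono) auto
  also have "\<dots> = real cell_shifts / base + real d" using pos by (simp add: field_simps)
  also have "\<dots> \<le> 2 * real cell_shifts / base"
    using cell_shifts_bounds(2) pos by (simp add: field_simps)
  finally show ?thesis .
qed

abbreviation "shifts \<equiv> {..<band_shifts} \<times> {..<cell_shifts}"

lemma card_bucket_neq_le:
  assumes "x \<in> V" "y \<in> V"
    and "opp_dist x \<le> base\<^sup>2 * opp_dist y" "opp_dist y \<le> base\<^sup>2 * opp_dist x"
    and "eucl_dist d x y \<le> base\<^sup>2 * opp_dist x"
  shows "real (card {(h, q) \<in> shifts. bucket h q x \<noteq> bucket h q y}) \<le> 5 * \<epsilon> * real (card shifts)"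
proof -
  let ?m = "real band_shifts" and ?M = "real cell_shifts"
  have "real (card {(h, q) \<in> shifts. bucket h q x \<noteq> bucket h q y})
    \<le> real (card {h\<in>{..<band_shifts}. band h x \<noteq> band h y}) * real (card {..<cell_shifts})
      + real (card {..<band_shifts}) * (2 * ?M / base)"
    using card_cell_neq_le[OF assms(1) _ assms(5)] base_ge
    by (intro card_Collect_Times_le) (auto simp: bucket_def)
  also have "\<dots> \<le> 3 * ?M + ?m * (2 * ?M / base)"
    using mult_right_mono[OF card_band_neq_le[OF assms(1-4)], of ?M] by simp
  also have "\<dots> \<le> 3 * (?m / base) * ?M + ?m * (2 * ?M / base)"
  proof -
    have "3 * 1 \<le> 3 * (?m / base)" using band_shifts_bounds(2) base_ge by (simp add: field_simps)
    from mult_right_mono[OF this, of ?M] show ?thesis by (intro add_right_mono) simp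
  qed
  also have "\<dots> = 5 * \<epsilon> * real (card shifts)"
    by (simp add: base_def card_cartesian_product algebra_simps)
  finally show ?thesis .
qed

lemma card_not_linked_block_le:
  assumes ab: "a \<in> A" "b \<in> B"
  shows "real (card {(h, q) \<in> shifts. \<not> linked (eucl_dist d) A B (block \<epsilon> (bucket h q)) \<epsilon> a b})
    \<le> 5 * \<epsilon> * real (card shifts)"
proof (cases "\<exists>v\<in>{a, b}. 3 * opp_dist v \<le> \<epsilon> * eucl_dist d a b")
  case True
  then have no_failure:
    "{(h, q) \<in> shifts. \<not> linked (eucl_dist d) A B (block \<epsilon> (bucket h q)) \<epsilon> a b} = {}"
    using linked_block_if_opp_dist_le[OF ab] by blast
  show ?thesis unfolding no_failure using eps_pos by simp
next
  case False
  define \<Delta> where "\<Delta> = eucl_dist d a b"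
  have far: "\<epsilon> * \<Delta> < 3 * opp_dist a" "\<epsilon> * \<Delta> < 3 * opp_dist b"
    using False by (auto simp: \<Delta>_def)
  show ?thesis
  proof (rule linking_keys[OF _ _ ab far[unfolded \<Delta>_def], folded \<Delta>_def])
    fix x y assume V: "x \<in> V" "y \<in> V"
      and x: "\<epsilon> * \<Delta> \<le> 6 * opp_dist x" "opp_dist x \<le> 2 * \<Delta>"
      and y: "\<epsilon> * \<Delta> \<le> 6 * opp_dist y" "opp_dist y \<le> 2 * \<Delta>"
      and xy: "eucl_dist d x y \<le> 7 * \<Delta>"
      and key: "\<And>key :: _ \<Rightarrow> int \<times> (nat \<Rightarrow> int). key x = key y \<Longrightarrow>
        linked (eucl_dist d) A B (block \<epsilon> key) \<epsilon> a b"
    have scale: "7 * \<Delta> \<le> base\<^sup>2 * t" if "\<epsilon> * \<Delta> \<le> 6 * t" "0 < t" for t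
    proof -
      have "\<Delta> \<le> 6 * base * t" using that eps_pos by (simp add: base_def field_simps)
      then have "7 * \<Delta> \<le> (42 * base) * t" by linarith
      also have "\<dots> \<le> base\<^sup>2 * t"
        using base_ge that(2) by (intro mult_right_mono) (auto simp: power2_eq_square)
      finally show ?thesis .
    qed
    have "0 \<le> \<Delta>" by (simp add: \<Delta>_def)
    then have "real (card {(h, q) \<in> shifts. bucket h q x \<noteq> bucket h q y})
      \<le> 5 * \<epsilon> * real (card shifts)"
      using scale[OF x(1) opp_dist_pos[OF V(1)]] scale[OF y(1) opp_dist_pos[OF V(2)]] V x(2) y(2) xy
      by (intro card_bucket_neq_le) linarith+
    moreover have "card {(h, q) \<in> shifts. \<not> linked (eucl_dist d) A B (block \<epsilon> (bucket h q)) \<epsilon> a b}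
      \<le> card {(h, q) \<in> shifts. bucket h q x \<noteq> bucket h q y}"
      using key by (intro card_mono) (auto intro: finite_subset[of _ shifts])
    ultimately show ?thesis by linarith
  qed (use eps_pos eps_small in auto)
qed

lemma exists_linked_family:
  assumes "card A = card B"
  shows "\<exists>f :: nat \<times> nat \<Rightarrow> (nat \<Rightarrow> real) \<Rightarrow> nat.
    linked_family (eucl_dist d) A B (swap_size d \<epsilon>) 3 \<epsilon> (5 * \<epsilon>) shifts f"
proof -
  have "\<forall>\<omega>. \<exists>g :: _ \<Rightarrow> nat.
    balanced_labeling A B (swap_size d \<epsilon>) (g \<circ> block \<epsilon> (bucket (fst \<omega>) (snd \<omega>)))"
    using exists_balanced_block_labeling[OF assms] by blast
  then obtain g :: "nat \<times> nat \<Rightarrow> _ \<Rightarrow> nat" where g: "\<And>\<omega>.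
    balanced_labeling A B (swap_size d \<epsilon>) (g \<omega> \<circ> block \<epsilon> (bucket (fst \<omega>) (snd \<omega>)))"
    by (metis (no_types))
  define f where "f \<omega> = g \<omega> \<circ> block \<epsilon> (bucket (fst \<omega>) (snd \<omega>))" for \<omega>
  have "linked_family (eucl_dist d) A B (swap_size d \<epsilon>) 3 \<epsilon> (5 * \<epsilon>) shifts f"
  proof
    show "finite shifts" "shifts \<noteq> {}"
      using band_shifts_bounds(1) cell_shifts_bounds(1) by auto
    fix \<omega>
    show "balanced_labeling A B (swap_size d \<epsilon>) (f \<omega>)" unfolding f_def by (rule g)
    fix a b assume ab: "a \<in> A" "b \<in> B"
    show "linked (eucl_dist d) A B (f \<omega>) 3 a b"
      unfolding f_def using opp_dist_pair_le(1)[OF ab]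
      by (intro linked_comp linked_block_if_opp_dist_le[OF ab, of a]) auto
  next
    fix a b assume ab: "a \<in> A" "b \<in> B"
    have "{\<omega>\<in>shifts. \<not> linked (eucl_dist d) A B (f \<omega>) \<epsilon> a b}
      \<subseteq> {(h, q) \<in> shifts. \<not> linked (eucl_dist d) A B (block \<epsilon> (bucket h q)) \<epsilon> a b}"
      unfolding f_def using linked_comp by fastforce
    then have "card {\<omega>\<in>shifts. \<not> linked (eucl_dist d) A B (f \<omega>) \<epsilon> a b}
      \<le> card {(h, q) \<in> shifts. \<not> linked (eucl_dist d) A B (block \<epsilon> (bucket h q)) \<epsilon> a b}"
      by (intro card_mono) (auto intro: finite_subset[of _ shifts])
    then show "real (card {\<omega>\<in>shifts. \<not> linked (eucl_dist d) A B (f \<omega>) \<epsilon> a b})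
      \<le> 5 * \<epsilon> * real (card shifts)"
      using card_not_linked_block_le[OF ab] by linarith
  qed (use eps_pos in auto)
  then show ?thesis by blast
qed

end

subsection \<open>Clients and swaps\<close>

lemma dist_to_centers_le: "finite S \<Longrightarrow> i \<in> S \<Longrightarrow> dist_to_centers d j S \<le> eucl_dist d j i"
  by (simp add: dist_to_centers_def)

lemma dist_to_centers_attained:
  assumes "finite S" "S \<noteq> {}"
  obtains i where "i \<in> S" "dist_to_centers d j S = eucl_dist d j i"
proof -
  have "dist_to_centers d j S \<in> eucl_dist d j ` S"
    unfolding dist_to_centers_def using assms by (intro Min_in) auto
  with that show ?thesis by blast
qed

lemma dist_to_centers_nonneg: "finite S \<Longrightarrow> S \<noteq> {} \<Longrightarrow> 0 \<le> dist_to_centers d j S"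
  by (metis dist_to_centers_attained eucl_dist_nonneg)

definition detour_loss :: "real \<Rightarrow> real" where
  "detour_loss \<tau> = 2 * (2 * \<tau> + \<tau>\<^sup>2)"

lemma detour_loss_nonneg: "0 \<le> \<tau> \<Longrightarrow> 0 \<le> detour_loss \<tau>"
  by (simp add: detour_loss_def)

lemma detour_loss_le: "0 \<le> \<tau> \<Longrightarrow> \<tau> \<le> 1 \<Longrightarrow> detour_loss \<tau> \<le> 6 * \<tau>"
  by (simp add: detour_loss_def power2_eq_square mult_left_le)

lemma detour_square_le:
  fixes c e \<tau> u :: real
  assumes "0 \<le> c" "0 \<le> e" "0 \<le> \<tau>" "0 \<le> u" "u \<le> c + e"
  shows "(u + \<tau> * (c + e))\<^sup>2 \<le> u\<^sup>2 + detour_loss \<tau> * (c\<^sup>2 + e\<^sup>2)"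
proof -
  have "(u + \<tau> * (c + e))\<^sup>2 = u\<^sup>2 + 2 * \<tau> * (u * (c + e)) + \<tau>\<^sup>2 * (c + e)\<^sup>2"
    by (simp add: power2_eq_square algebra_simps)
  also have "\<dots> \<le> u\<^sup>2 + 2 * \<tau> * ((c + e) * (c + e)) + \<tau>\<^sup>2 * (c + e)\<^sup>2"
    using assms by (intro add_mono mult_left_mono mult_right_mono) auto
  also have "\<dots> = u\<^sup>2 + (2 * \<tau> + \<tau>\<^sup>2) * (c + e)\<^sup>2"
    by (simp add: power2_eq_square algebra_simps)
  also have "\<dots> \<le> u\<^sup>2 + (2 * \<tau> + \<tau>\<^sup>2) * (2 * (c\<^sup>2 + e\<^sup>2))"
    using sum_squares_bound[of c e] assms(3)
    by (intro add_left_mono mult_left_mono) (auto simp: power2_sum)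
  finally show ?thesis by (simp add: detour_loss_def algebra_simps)
qed

definition swapped :: "'a set \<Rightarrow> 'a set \<Rightarrow> ('a \<Rightarrow> 'l) \<Rightarrow> 'l \<Rightarrow> 'a set" where
  "swapped S T f l = (S - {a \<in> S - T. f a = l}) \<union> {b \<in> T - S. f b = l}"

lemma finite_swapped: "finite S \<Longrightarrow> finite T \<Longrightarrow> finite (swapped S T f l)"
  by (simp add: swapped_def)

lemma swapped_nonempty:
  assumes "balanced_labeling (S - T) (T - S) \<rho> f" "finite S" "S \<noteq> {}"
  shows "swapped S T f l \<noteq> {}"
proof
  assume empty: "swapped S T f l = {}"
  then have "{b \<in> T - S. f b = l} = {}" by (simp add: swapped_def)
  then have "card {a \<in> S - T. f a = l} = 0"
    using balanced_labelingD(1)[OF assms(1), of l] by (simp only: card.empty)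
  then have "{a \<in> S - T. f a = l} = {}" using assms(2) by simp
  then have "S \<subseteq> swapped S T f l" by (auto simp: swapped_def)
  with empty assms(3) show False by simp
qed

definition swap_change ::
  "nat \<Rightarrow> (nat \<Rightarrow> real) set \<Rightarrow> (nat \<Rightarrow> real) set \<Rightarrow> ((nat \<Rightarrow> real) \<Rightarrow> 'l) \<Rightarrow> 'l \<Rightarrow> (nat \<Rightarrow> real) \<Rightarrow> real"
  where "swap_change d S T f l j =
    (dist_to_centers d j (swapped S T f l))\<^sup>2 - (dist_to_centers d j S)\<^sup>2"

lemma sum_swap_change_nonneg:
  assumes "swap_locally_optimal d X C \<rho> S" "balanced_labeling (S - T) (T - S) \<rho> f" "T \<subseteq> C"
  shows "0 \<le> (\<Sum>j\<in>X. swap_change d S T f l j)"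
proof -
  let ?P = "{b \<in> T - S. f b = l}" and ?Q = "{a \<in> S - T. f a = l}"
  have "?P \<subseteq> C - S" "?Q \<subseteq> S" "card ?P = card ?Q" "real (card ?Q) \<le> \<rho>"
    using assms(3) balanced_labelingD[OF assms(2), of l] by auto
  then have "\<not> kmeans_cost d X (swapped S T f l) < kmeans_cost d X S"
    using assms(1) unfolding swap_locally_optimal_def swapped_def by blast
  then show ?thesis by (simp add: swap_change_def kmeans_cost_def sum_subtractf)
qed

lemma sum_le_elem_if_others_nonpos:
  fixes g :: "'a \<Rightarrow> 'b::ordered_ab_group_add"
  assumes "finite N" "n \<in> N" "\<And>n'. n' \<in> N \<Longrightarrow> n' \<noteq> n \<Longrightarrow> g n' \<le> 0"
  shows "sum g N \<le> g n"
  using assms sum_nonpos[of "N - {n}" g] by (simp add: sum.remove)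

locale client =
  fixes d :: nat and S T :: "(nat \<Rightarrow> real) set" and f :: "(nat \<Rightarrow> real) \<Rightarrow> 'l"
    and j i i' :: "nat \<Rightarrow> real"
  assumes finite_S_T: "finite S" "finite T" and swapped_neq_empty: "\<And>l. swapped S T f l \<noteq> {}"
    and nearest_S: "i \<in> S" "dist_to_centers d j S = eucl_dist d j i"
    and nearest_T: "i' \<in> T" "dist_to_centers d j T = eucl_dist d j i'"
begin

abbreviation "dist_S \<equiv> eucl_dist d j i"

abbreviation "dist_T \<equiv> eucl_dist d j i'"

abbreviation "change l \<equiv> swap_change d S T f l j"

lemma change_le:
  assumes "w \<in> swapped S T f l" "eucl_dist d j w \<le> y"
  shows "change l \<le> y\<^sup>2 - dist_S\<^sup>2"
proof -
  have "dist_to_centers d j (swapped S T f l) \<le> y"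
    using dist_to_centers_le[OF finite_swapped[OF finite_S_T] assms(1), of d j] assms(2) by simp
  then show ?thesis
    using dist_to_centers_nonneg[OF finite_swapped[OF finite_S_T] swapped_neq_empty]
    by (simp add: swap_change_def nearest_S(2) power_mono)
qed

lemma change_nonpos: "i \<notin> S - T \<or> f i \<noteq> l \<Longrightarrow> change l \<le> 0"
  using change_le[of i l dist_S] nearest_S(1) by (auto simp: swapped_def)

lemma change_le_dist_diff: "i' \<in> S \<or> f i' = l \<Longrightarrow> change l \<le> dist_T\<^sup>2 - dist_S\<^sup>2"
  using change_le[of i' l dist_T] nearest_T(1) by (auto simp: swapped_def)

lemma dist_S_le_if_common: "i' \<in> S \<Longrightarrow> dist_S\<^sup>2 \<le> dist_T\<^sup>2"
  using dist_to_centers_le[OF finite_S_T(1), of i' d j] nearest_S(2) by (intro power_mono) auto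

text \<open>Whichever of the two linked centers is open, a detour to it costs at most \<open>\<tau> * \<delta> i i'\<close>.\<close>

lemma change_le_if_linked:
  assumes "0 \<le> \<tau>" "linked (eucl_dist d) (S - T) (T - S) f \<tau> i i'"
  shows "change l \<le> max 0 (dist_T\<^sup>2 - dist_S\<^sup>2) + detour_loss \<tau> * (dist_S\<^sup>2 + dist_T\<^sup>2)"
proof -
  obtain s t where st: "s \<in> S - T" "t \<in> T - S" "f s = f t"
    and near: "\<forall>v\<in>{s, t}. min (eucl_dist d v i) (eucl_dist d v i') \<le> \<tau> * eucl_dist d i i'"
    using assms(2) unfolding linked_def by blast
  have "\<exists>w\<in>{s, t}. w \<in> swapped S T f l"
    using st by (cases "f s = l") (auto simp: swapped_def)
  then obtain w where w: "w \<in> swapped S T f l"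
    "min (eucl_dist d w i) (eucl_dist d w i') \<le> \<tau> * eucl_dist d i i'"
    using near by blast
  have "eucl_dist d i i' \<le> dist_S + dist_T"
    using eucl_dist_triangle[of d i i' j] eucl_dist_commute[of d i j] by simp
  then have "\<tau> * eucl_dist d i i' \<le> \<tau> * (dist_S + dist_T)" using assms(1) by (rule mult_left_mono)
  then obtain v where v: "v \<in> {i, i'}" "eucl_dist d w v \<le> \<tau> * (dist_S + dist_T)"
    using w(2) by (auto simp: min_le_iff_disj intro: order_trans)
  then have "eucl_dist d j w \<le> eucl_dist d j v + \<tau> * (dist_S + dist_T)"
    using eucl_dist_triangle[of d j w v] eucl_dist_commute[of d w v] by simp
  then have "change l \<le> (eucl_dist d j v + \<tau> * (dist_S + dist_T))\<^sup>2 - dist_S\<^sup>2"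
    by (rule change_le[OF w(1)])
  also have "\<dots> \<le> (eucl_dist d j v)\<^sup>2 + detour_loss \<tau> * (dist_S\<^sup>2 + dist_T\<^sup>2) - dist_S\<^sup>2"
    using v(1) assms(1) by (intro diff_right_mono detour_square_le) auto
  finally show ?thesis using v(1) by auto
qed

text \<open>
  Only the swap that closes \<open>i\<close> can increase the distance of the client; the swap that opens \<open>i'\<close>
  makes up for this.
\<close>

lemma sum_change_le:
  assumes N: "finite N" "f ` ((S - T) \<union> (T - S)) \<subseteq> N" and "0 \<le> \<tau>"
    and link: "i \<in> S - T \<Longrightarrow> i' \<in> T - S \<Longrightarrow> linked (eucl_dist d) (S - T) (T - S) f \<tau> i i'"
  shows "(\<Sum>l\<in>N. change l)
    \<le> dist_T\<^sup>2 - dist_S\<^sup>2 + detour_loss \<tau> * (dist_S\<^sup>2 + dist_T\<^sup>2)"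
proof -
  let ?loss = "detour_loss \<tau> * (dist_S\<^sup>2 + dist_T\<^sup>2)"
  have loss: "0 \<le> ?loss" using detour_loss_nonneg[OF \<open>0 \<le> \<tau>\<close>] by simp
  consider (stays) "i \<notin> S - T" "i' \<in> S" | (opens) "i \<notin> S - T" "i' \<in> T - S"
    | (same_swap) "i \<in> S - T" "i' \<in> S \<or> f i' = f i"
    | (two_swaps) "i \<in> S - T" "i' \<in> T - S" "f i' \<noteq> f i"
    using nearest_T(1) by blast
  then show ?thesis
  proof cases
    case stays
    then have "(\<Sum>l\<in>N. change l) \<le> 0" using change_nonpos by (intro sum_nonpos) blast
    with dist_S_le_if_common[OF stays(2)] loss show ?thesis by linarith
  next
    case opens
    then have "(\<Sum>l\<in>N. change l) \<le> change (f i')"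
      using N change_nonpos by (intro sum_le_elem_if_others_nonpos) auto
    with change_le_dist_diff[of "f i'"] loss show ?thesis by simp
  next
    case same_swap
    then have "(\<Sum>l\<in>N. change l) \<le> change (f i)"
      using N change_nonpos by (intro sum_le_elem_if_others_nonpos) auto
    with change_le_dist_diff[OF same_swap(2)] loss show ?thesis by linarith
  next
    case two_swaps
    then have labels: "f i \<in> N" "f i' \<in> N - {f i}" using N(2) by auto
    have "(\<Sum>l\<in>N. change l) = change (f i) + (\<Sum>l\<in>N - {f i}. change l)"
      using N(1) labels(1) by (rule sum.remove)
    also have "(\<Sum>l\<in>N - {f i}. change l) \<le> change (f i')"
      using N(1) labels(2) change_nonpos by (intro sum_le_elem_if_others_nonpos) auto
    also have "change (f i') \<le> min 0 (dist_T\<^sup>2 - dist_S\<^sup>2)"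
      using change_nonpos change_le_dist_diff two_swaps(3) by auto
    also have "change (f i) \<le> max 0 (dist_T\<^sup>2 - dist_S\<^sup>2) + ?loss"
      using two_swaps link \<open>0 \<le> \<tau>\<close> by (intro change_le_if_linked) auto
    finally show ?thesis by linarith
  qed
qed

end

lemma (in linked_family) sum_not_linked_le:
  assumes "0 \<le> r"
  shows "(\<Sum>\<omega>\<in>\<Omega>. if a \<in> A \<and> b \<in> B \<and> \<not> linked \<delta> A B (f \<omega>) \<tau> a b then r else 0)
    \<le> real (card \<Omega>) * (p * r)"
proof (cases "a \<in> A \<and> b \<in> B")
  case True
  have "(\<Sum>\<omega>\<in>\<Omega>. if \<not> linked \<delta> A B (f \<omega>) \<tau> a b then r else 0)
    = real (card {\<omega>\<in>\<Omega>. \<not> linked \<delta> A B (f \<omega>) \<tau> a b}) * r"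
    using finite_nonempty(1) by (simp add: sum.If_cases Int_def)
  also have "\<dots> \<le> p * real (card \<Omega>) * r"
    using mostly_linked True assms by (intro mult_right_mono) auto
  finally show ?thesis using True by (simp add: mult_ac)
next
  case False
  then show ?thesis using assms nonneg(3) by auto
qed

lemma sum_swap_change_family_le:
  fixes j :: "nat \<Rightarrow> real"
  assumes family: "linked_family (eucl_dist d) (S - T) (T - S) \<rho> \<sigma> \<tau> p \<Omega> f"
    and fin: "finite S" "finite T" and nonempty: "S \<noteq> {}" "T \<noteq> {}"
  defines "c \<equiv> dist_to_centers d j S" and "e \<equiv> dist_to_centers d j T"
  shows "(\<Sum>\<omega>\<in>\<Omega>. \<Sum>l\<in>f \<omega> ` ((S - T) \<union> (T - S)). swap_change d S T (f \<omega>) l j)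
    \<le> real (card \<Omega>) * (e\<^sup>2 - c\<^sup>2 + (detour_loss \<tau> + p * detour_loss \<sigma>) * (c\<^sup>2 + e\<^sup>2))"
proof -
  interpret linked_family "eucl_dist d" "S - T" "T - S" \<rho> \<sigma> \<tau> p \<Omega> f by (rule family)
  let ?labels = "\<lambda>\<omega>. f \<omega> ` ((S - T) \<union> (T - S))"
  obtain i where i: "i \<in> S" "dist_to_centers d j S = eucl_dist d j i"
    using dist_to_centers_attained[OF fin(1) nonempty(1)] by blast
  obtain i' where i': "i' \<in> T" "dist_to_centers d j T = eucl_dist d j i'"
    using dist_to_centers_attained[OF fin(2) nonempty(2)] by blast
  define y where "y = c\<^sup>2 + e\<^sup>2"
  define loss where "loss = detour_loss \<sigma> * y"
  have loss: "0 \<le> detour_loss \<tau> * y" "0 \<le> loss"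
    using detour_loss_nonneg nonneg(1,2) by (simp_all add: loss_def y_def)
  let ?fails = "\<lambda>\<omega>. i \<in> S - T \<and> i' \<in> T - S \<and> \<not> linked (eucl_dist d) (S - T) (T - S) (f \<omega>) \<tau> i i'"
  have change: "(\<Sum>l\<in>?labels \<omega>. swap_change d S T (f \<omega>) l j)
    \<le> (e\<^sup>2 - c\<^sup>2 + detour_loss \<tau> * y) + (if ?fails \<omega> then loss else 0)" if "\<omega> \<in> \<Omega>" for \<omega>
  proof -
    interpret client d S T "f \<omega>" j i i'
      using fin swapped_nonempty[OF balanced[OF that] fin(1) nonempty(1)] i i' by unfold_locales
    have "(\<Sum>l\<in>?labels \<omega>. swap_change d S T (f \<omega>) l j) \<le> e\<^sup>2 - c\<^sup>2 + detour_loss \<theta> * y"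
      if "0 \<le> \<theta>"
        "i \<in> S - T \<Longrightarrow> i' \<in> T - S \<Longrightarrow> linked (eucl_dist d) (S - T) (T - S) (f \<omega>) \<theta> i i'" for \<theta>
      using sum_change_le[of "?labels \<omega>" \<theta>] that fin i(2) i'(2) by (simp add: c_def e_def y_def)
    from this[of \<tau>] this[of \<sigma>] show ?thesis
      using nonneg(1,2) always_linked[OF that] loss by (auto simp: loss_def)
  qed
  have "(\<Sum>\<omega>\<in>\<Omega>. \<Sum>l\<in>?labels \<omega>. swap_change d S T (f \<omega>) l j)
    \<le> (\<Sum>\<omega>\<in>\<Omega>. (e\<^sup>2 - c\<^sup>2 + detour_loss \<tau> * y) + (if ?fails \<omega> then loss else 0))"
    by (intro sum_mono change)
  also have "\<dots> = real (card \<Omega>) * (e\<^sup>2 - c\<^sup>2 + detour_loss \<tau> * y)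
    + (\<Sum>\<omega>\<in>\<Omega>. if ?fails \<omega> then loss else 0)"
    by (subst sum.distrib) simp
  also have "\<dots> \<le> real (card \<Omega>) * (e\<^sup>2 - c\<^sup>2 + detour_loss \<tau> * y) + real (card \<Omega>) * (p * loss)"
    using sum_not_linked_le[OF loss(2)] by (rule add_left_mono)
  also have "\<dots> = real (card \<Omega>) * (e\<^sup>2 - c\<^sup>2 + (detour_loss \<tau> + p * detour_loss \<sigma>) * y)"
    by (simp add: loss_def algebra_simps)
  finally show ?thesis by (simp only: y_def)
qed

lemma kmeans_cost_le_if_linked_family:
  assumes family: "linked_family (eucl_dist d) (S - T) (T - S) \<rho> \<sigma> \<tau> p \<Omega> f"
    and sets: "finite S" "finite T" "S \<noteq> {}" "T \<noteq> {}" "T \<subseteq> C"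
    and local_opt: "swap_locally_optimal d X C \<rho> S"
  defines "z \<equiv> detour_loss \<tau> + p * detour_loss \<sigma>"
  shows "kmeans_cost d X S \<le> kmeans_cost d X T + z * (kmeans_cost d X S + kmeans_cost d X T)"
proof -
  interpret linked_family "eucl_dist d" "S - T" "T - S" \<rho> \<sigma> \<tau> p \<Omega> f by (rule family)
  let ?labels = "\<lambda>\<omega>. f \<omega> ` ((S - T) \<union> (T - S))"
  let ?c = "\<lambda>j. dist_to_centers d j S" and ?e = "\<lambda>j. dist_to_centers d j T"
  have "0 \<le> (\<Sum>\<omega>\<in>\<Omega>. \<Sum>l\<in>?labels \<omega>. \<Sum>j\<in>X. swap_change d S T (f \<omega>) l j)"
    using sum_swap_change_nonneg[OF local_opt balanced sets(5)]
    by (rule sum_nonneg[OF sum_nonneg])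
  also have "\<dots> = (\<Sum>\<omega>\<in>\<Omega>. \<Sum>j\<in>X. \<Sum>l\<in>?labels \<omega>. swap_change d S T (f \<omega>) l j)"
    by (intro sum.cong refl sum.swap)
  also have "\<dots> = (\<Sum>j\<in>X. \<Sum>\<omega>\<in>\<Omega>. \<Sum>l\<in>?labels \<omega>. swap_change d S T (f \<omega>) l j)"
    by (rule sum.swap)
  also have "\<dots> \<le> (\<Sum>j\<in>X. real (card \<Omega>) * ((?e j)\<^sup>2 - (?c j)\<^sup>2 + z * ((?c j)\<^sup>2 + (?e j)\<^sup>2)))"
    unfolding z_def by (intro sum_mono sum_swap_change_family_le[OF family sets(1-4)])
  also have "\<dots> = real (card \<Omega>) * (kmeans_cost d X T - kmeans_cost d X S
    + z * (kmeans_cost d X S + kmeans_cost d X T))"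
    by (simp add: kmeans_cost_def sum_distrib_left sum.distrib sum_subtractf algebra_simps)
  finally have "0 \<le> kmeans_cost d X T - kmeans_cost d X S
    + z * (kmeans_cost d X S + kmeans_cost d X T)"
    using finite_nonempty by (simp add: zero_le_mult_iff card_gt_0_iff)
  then show ?thesis by simp
qed

lemma local_optimum_kmeans_cost_le:
  assumes eps: "0 < \<epsilon>" "\<epsilon> \<le> 1 / 42" and "0 < d"
    and fin: "finite S" "finite T" and card: "card S = card T" and "S \<noteq> {}"
    and space: "S \<union> T \<subseteq> topspace (Euclidean_space d)" and "T \<subseteq> C"
    and local_opt: "swap_locally_optimal d X C (swap_size d \<epsilon>) S"
  shows "kmeans_cost d X S \<le> kmeans_cost d X T
    + 156 * \<epsilon> * (kmeans_cost d X S + kmeans_cost d X T)"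
proof -
  have card_Diff: "card (S - T) = card (T - S)"
    using fin card by (intro antisym card_le_sym_Diff) auto
  then have "S - T = {} \<longleftrightarrow> T - S = {}"
    using fin card_gt_0_iff[of "S - T"] card_gt_0_iff[of "T - S"] by auto
  then interpret euclidean_bichromatic d "S - T" "T - S" \<epsilon>
    using Metric_space_eucl_dist fin space eps \<open>0 < d\<close>
    by (intro euclidean_bichromatic.intro bichromatic.intro bichromatic_axioms.intro
        euclidean_bichromatic_axioms.intro) auto
  obtain f :: "nat \<times> nat \<Rightarrow> (nat \<Rightarrow> real) \<Rightarrow> nat" where
    "linked_family (eucl_dist d) (S - T) (T - S) (swap_size d \<epsilon>) 3 \<epsilon> (5 * \<epsilon>) shifts f"
    using exists_linked_family[OF card_Diff] by blast
  moreover have "T \<noteq> {}" using card fin \<open>S \<noteq> {}\<close> by auto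
  ultimately have "kmeans_cost d X S \<le> kmeans_cost d X T
    + (detour_loss \<epsilon> + 5 * \<epsilon> * detour_loss 3) * (kmeans_cost d X S + kmeans_cost d X T)"
    using fin \<open>S \<noteq> {}\<close> \<open>T \<subseteq> C\<close> local_opt by (intro kmeans_cost_le_if_linked_family)
  also have "\<dots> \<le> kmeans_cost d X T
    + 156 * \<epsilon> * (kmeans_cost d X S + kmeans_cost d X T)"
  proof (intro add_left_mono mult_right_mono)
    have "detour_loss 3 = 30" by (simp add: detour_loss_def)
    then show "detour_loss \<epsilon> + 5 * \<epsilon> * detour_loss 3 \<le> 156 * \<epsilon>"
      using detour_loss_le[of \<epsilon>] eps by simp
  qed (simp add: kmeans_cost_def sum_nonneg)
  finally show ?thesis .
qed

lemma le_mult_if_le_add_mult_add: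
  fixes s t z :: real
  assumes "s \<le> t + z * (s + t)" "0 \<le> z" "z \<le> 1 / 2" "0 \<le> t"
  shows "s \<le> (1 + 4 * z) * t"
proof -
  have "z * z \<le> 1 / 2 * z" using assms by (intro mult_right_mono)
  then have "1 + z \<le> (1 - z) * (1 + 4 * z)" by (simp add: algebra_simps)
  then have "(1 + z) * t \<le> (1 - z) * (1 + 4 * z) * t" using assms(4) by (rule mult_right_mono)
  moreover have "(1 - z) * s \<le> (1 + z) * t" using assms(1) by (simp add: algebra_simps)
  ultimately have "(1 - z) * s \<le> (1 - z) * ((1 + 4 * z) * t)" by (simp add: mult.assoc)
  then show ?thesis using assms(3) by simp
qed

theorem theorem4:
  shows "\<exists>c \<epsilon>\<^sub>0 :: real. c > 0 \<and> 0 < \<epsilon>\<^sub>0 \<and> \<epsilon>\<^sub>0 < 1 \<and>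
    (\<forall>(\<epsilon>::real) (d::nat) (X::(nat \<Rightarrow> real) set) (C::(nat \<Rightarrow> real) set) (k::nat)
       (S::(nat \<Rightarrow> real) set) (Opt::(nat \<Rightarrow> real) set).
       0 < \<epsilon> \<longrightarrow> \<epsilon> < \<epsilon>\<^sub>0 \<longrightarrow> 2 \<le> d \<longrightarrow>
       finite X \<longrightarrow> X \<subseteq> topspace (Euclidean_space d) \<longrightarrow>
       finite C \<longrightarrow> C \<subseteq> topspace (Euclidean_space d) \<longrightarrow>
       1 \<le> k \<longrightarrow> k \<le> card C \<longrightarrow>
       S \<subseteq> C \<longrightarrow> card S = k \<longrightarrow> swap_locally_optimal d X C (swap_size d \<epsilon>) S \<longrightarrow>
       Opt \<subseteq> C \<longrightarrow> card Opt = k \<longrightarrow>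
       (\<forall>T. T \<subseteq> C \<longrightarrow> card T = k \<longrightarrow> kmeans_cost d X Opt \<le> kmeans_cost d X T) \<longrightarrow>
       kmeans_cost d X S \<le> (1 + c * \<epsilon>) * kmeans_cost d X Opt)"
proof (rule exI[of _ 624], rule exI[of _ "1 / 312"], intro conjI allI impI)
  fix \<epsilon> :: real and d k :: nat and X C S Opt :: "(nat \<Rightarrow> real) set"
  assume eps: "0 < \<epsilon>" "\<epsilon> < 1 / 312" and "2 \<le> d"
    and C: "finite C" "C \<subseteq> topspace (Euclidean_space d)" and "1 \<le> k"
    and S: "S \<subseteq> C" "card S = k" and local_opt: "swap_locally_optimal d X C (swap_size d \<epsilon>) S"
    and Opt: "Opt \<subseteq> C" "card Opt = k"
  have "S \<noteq> {}" using S(2) \<open>1 \<le> k\<close> by auto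
  then have "kmeans_cost d X S \<le> kmeans_cost d X Opt
    + 156 * \<epsilon> * (kmeans_cost d X S + kmeans_cost d X Opt)"
    using eps \<open>2 \<le> d\<close> C S Opt local_opt finite_subset[OF _ C(1)]
    by (intro local_optimum_kmeans_cost_le[where C = C]) auto
  moreover have "0 \<le> kmeans_cost d X Opt" by (simp add: kmeans_cost_def sum_nonneg)
  ultimately show "kmeans_cost d X S \<le> (1 + 624 * \<epsilon>) * kmeans_cost d X Opt"
    using le_mult_if_le_add_mult_add[of "kmeans_cost d X S" _ "156 * \<epsilon>"] eps by simp
qed simp_all

end
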